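(* Let $n,m\geq 2$ and for each $1\leq i\leq m$ let $p(i)\in(0,\infty)$ and let $q_i:\mathbb{R}^n\to\mathbb{R}$ be a continuous function that is $C^3$ on $\mathbb{R}^n\setminus\{0\}$ and not identically zero, such that for all $x\in\mathbb{R}^n$ and all $\alpha\geq 0$, $q_i(\alpha x)=\alpha^{p(i)}q_i(x)$. Assume that $p(1)>\max_{2\leq i\leq m}p(i)$. Define $f:\mathbb{R}^n\to(0,\infty)$ as $$f(x)=\exp\left(-\sum_{i=1}^{m}q_i(x)\right).$$ Let $\mathcal{M}=\{\theta\in\mathbb{R}^n:|q_1(\theta)|=1\}$ and consider any $\theta\in\mathcal{M}$ such that $\kappa(\theta)\neq 0$, where $\kappa(\theta)$ is the Gauss-Kronecker curvature of $\mathcal{M}$ at $\theta$. Then there exist $(\varepsilon_i)_{i=2}^{n}\in\{\pm1\}^{n-1}$ and a function $t\mapsto T_t$ from $[1,\infty)$ into $GL(n)$ such that the function $$x\mapsto\frac{f(t\theta+T_tx)}{f(t\theta)}$$ converges uniformly on compact subsets of $\mathbb{R}^n$ to the function $x\mapsto\exp\left(-x_1-\pi\sum_{i=2}^{n}\varepsilon_ix_i^2\right)$ as $t\to\infty$.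
   Context: $GL(n)$ is the group of invertible real $n\times n$ matrices. Gauss-Kronecker curvature: for a $C^3$ hypersurface $\mathcal{M}\subset\mathbb{R}^n$ of dimension $n-1$, a point $\theta\in\mathcal{M}$ and a unit normal $\mathbf{n}(\theta)$ to $\mathcal{M}$ at $\theta$, there is an affine isometry $J$ of $\mathbb{R}^n$ with $J(\theta)=0$, whose linear part maps $\mathbf{n}(\theta)$ to $(0,\ldots,0,1)$, such that $J(\mathcal{M})$ coincides near $0$ with the graph of a $C^3$ function $\psi:\mathbb{R}^{n-1}\to\mathbb{R}$ with $\psi(0)=0$, $\nabla\psi(0)=0$; then $\kappa(\theta)=\det H_\psi(0)$, where $H_\psi$ is the Hessian. (The choice of normal affects only the sign of $\kappa(\theta)$, hence not whether it is zero.) *)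

theory Defs
  imports "HOL-Analysis.Analysis"
begin

text \<open>Intended for open \<open>S\<close>: there it says that \<open>f\<close> is of class \<open>C\<^sup>k\<close> on \<open>S\<close>.\<close>

primrec C_k_on :: "nat \<Rightarrow> ('a::euclidean_space \<Rightarrow> real) \<Rightarrow> 'a set \<Rightarrow> bool" where
  "C_k_on 0 f S \<longleftrightarrow> continuous_on S f"
| "C_k_on (Suc k) f S \<longleftrightarrow>
     (\<forall>x\<in>S. f differentiable (at x)) \<and>
     (\<forall>b\<in>Basis. C_k_on k (\<lambda>x. frechet_derivative f (at x) b) S)"

definition partial_deriv :: "'d::finite \<Rightarrow> (real^'d \<Rightarrow> real) \<Rightarrow> real^'d \<Rightarrow> real" where
  "partial_deriv i f x = frechet_derivative f (at x) (axis i 1)"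

definition hessian :: "(real^'d::finite \<Rightarrow> real) \<Rightarrow> real^'d \<Rightarrow> real^'d^'d" where
  "hessian f x = (\<chi> i j. partial_deriv i (partial_deriv j f) x)"

text \<open>
  \<open>has_gauss_kronecker_curvature TYPE('d) M \<nu> \<theta> k\<close>: near \<open>\<theta>\<close> the set \<open>M\<close> is a \<open>C\<^sup>3\<close> hypersurface
  of \<open>real^'n\<close>, \<open>\<nu>\<close> is a unit normal to \<open>M\<close> at \<open>\<theta>\<close>, and \<open>k\<close> is the Gauss-Kronecker curvature of
  \<open>M\<close> at \<open>\<theta>\<close> with respect to \<open>\<nu>\<close>.

  The target of the affine isometry \<open>J x = A (x - \<theta>)\<close> is \<open>real^'d \<times> real\<close>, whose norm is
  Euclidean, in place of a copy of \<open>real^'n\<close> with a distinguished last coordinate; such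
  an \<open>A\<close> exists only if \<open>CARD('n) = CARD('d) + 1\<close>.  That \<open>\<nu>\<close> has norm 1 and is normal to \<open>M\<close>
  follows from \<open>A \<nu> = (0, 1)\<close> and \<open>\<nabla>\<psi>(0) = 0\<close>.
\<close>

definition has_gauss_kronecker_curvature ::
    "'d::finite itself \<Rightarrow> (real^'n::finite) set \<Rightarrow> real^'n \<Rightarrow> real^'n \<Rightarrow> real \<Rightarrow> bool" where
  "has_gauss_kronecker_curvature (_ :: 'd::finite itself) M \<nu> \<theta> k \<longleftrightarrow>
     (\<exists>(A :: real^'n \<Rightarrow> (real^'d) \<times> real) (\<psi> :: real^'d \<Rightarrow> real) U.
        linear A \<and> (\<forall>x. norm (A x) = norm x) \<and> surj A \<and> A \<nu> = (0, 1) \<and>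
        C_k_on 3 \<psi> UNIV \<and> \<psi> 0 = 0 \<and> (GDERIV \<psi> 0 :> 0) \<and>
        open U \<and> 0 \<in> U \<and>
        (\<lambda>x. A (x - \<theta>)) ` M \<inter> U = range (\<lambda>y. (y, \<psi> y)) \<inter> U \<and>
        k = det (hessian \<psi> 0))"

end

theory Submission
  imports Defs
begin

text \<open>
  By homogeneity, \<open>q\<^sub>i (t\<theta> + t h) - q\<^sub>i (t\<theta>) = t\<^bsup>p i\<^esup> (q\<^sub>i (\<theta> + h) - q\<^sub>i \<theta>)\<close>.  Since
  \<open>Dq\<^sub>1(\<theta>) \<theta> = p\<^sub>1 q\<^sub>1(\<theta>) \<noteq> 0\<close>, the radial direction is transversal to the level set of \<open>q\<^sub>1\<close>, and
  nonzero curvature says that \<open>D\<^sup>2q\<^sub>1(\<theta>)\<close> is nondegenerate on the tangent space, where it has a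
  basis \<open>e\<^sub>i\<close> diagonalising it with entries \<open>\<plusminus>2\<pi>\<close>.  One takes \<open>h\<close> of order \<open>t\<^bsup>-p\<^sub>1\<^esup>\<close> along \<open>\<theta>\<close> and
  of order \<open>t\<^bsup>-p\<^sub>1/2\<^esup>\<close> along the \<open>e\<^sub>i\<close>.  The first-order terms of \<open>q\<^sub>i\<close>, \<open>i \<ge> 2\<close>, need not vanish in
  the limit when \<open>p\<^sub>i > p\<^sub>1/2\<close>; they are cancelled by projecting the \<open>e\<^sub>i\<close> along \<open>\<theta>\<close> onto the kernel of
  the differential of the whole sum at \<open>t\<theta>\<close>, a correction that tends to \<open>0\<close> because \<open>p\<^sub>1\<close> dominates.
\<close>

section \<open>Second derivatives\<close>

text \<open>Differentiation goes along \<open>h\<close> first and then along \<open>k\<close>;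
  symmetry is proved below. Since \<open>frechet_derivative\<close> has an arbitrary value where no
  derivative exists, the notion is used only under the next condition.\<close>

definition second_derivative ::
    "('a::euclidean_space \<Rightarrow> real) \<Rightarrow> 'a \<Rightarrow> 'a \<Rightarrow> 'a \<Rightarrow> real" where
  "second_derivative f x h k = frechet_derivative (\<lambda>y. frechet_derivative f (at y) h) (at x) k"

text \<open>Differentiability of the derivative at the single point \<open>x\<close>. Basis
  directions suffice: near \<open>x\<close>, where \<open>f\<close> is differentiable, the
  derivative is linear in the direction.\<close>

definition twice_differentiable_at :: "('a::euclidean_space \<Rightarrow> real) \<Rightarrow> 'a \<Rightarrow> bool" where
  "twice_differentiable_at f x \<longleftrightarrow>
     (\<forall>\<^sub>F y in nhds x. f differentiable (at y)) \<and>
     (\<forall>b\<in>Basis. (\<lambda>y. frechet_derivative f (at y) b) differentiable (at x))"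

lemma C_k_on_imp_twice_differentiable_at:
  assumes "C_k_on (Suc (Suc k)) f S" "open S" "x \<in> S"
  shows "twice_differentiable_at f x"
  using assms by (auto simp: twice_differentiable_at_def eventually_nhds)

lemma twice_differentiable_at_imp_differentiable:
  "twice_differentiable_at f x \<Longrightarrow> f differentiable (at x)"
  unfolding twice_differentiable_at_def by (auto dest: eventually_nhds_x_imp_x)

lemma frechet_derivative_Basis_sum:
  fixes f :: "'a::euclidean_space \<Rightarrow> real"
  assumes "f differentiable (at y)"
  shows "frechet_derivative f (at y) h = (\<Sum>b\<in>Basis. (h \<bullet> b) * frechet_derivative f (at y) b)"
proof -
  have lin: "linear (frechet_derivative f (at y))"
    using assms by (rule linear_frechet_derivative)
  have "frechet_derivative f (at y) h = frechet_derivative f (at y) (\<Sum>b\<in>Basis. (h \<bullet> b) *\<^sub>R b)"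
    by (simp add: euclidean_representation)
  also have "\<dots> = (\<Sum>b\<in>Basis. (h \<bullet> b) * frechet_derivative f (at y) b)"
    by (simp add: linear_sum[OF lin] linear_cmul[OF lin])
  finally show ?thesis .
qed

lemma has_field_derivative_along_line:
  fixes f :: "'a::euclidean_space \<Rightarrow> real"
  assumes "f differentiable (at (y + s *\<^sub>R h))"
  shows "((\<lambda>s. f (y + s *\<^sub>R h)) has_field_derivative frechet_derivative f (at (y + s *\<^sub>R h)) h) (at s)"
proof -
  have "((\<lambda>s. f (y + s *\<^sub>R h)) has_derivative (\<lambda>u. frechet_derivative f (at (y + s *\<^sub>R h)) (u *\<^sub>R h))) (at s)"
    by (rule has_derivative_compose[of "\<lambda>s. y + s *\<^sub>R h" "\<lambda>u. u *\<^sub>R h" s UNIV f, simplified])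
       (auto intro!: derivative_eq_intros frechet_derivative_works[THEN iffD1] assms)
  also have "(\<lambda>u. frechet_derivative f (at (y + s *\<^sub>R h)) (u *\<^sub>R h)) =
      (*) (frechet_derivative f (at (y + s *\<^sub>R h)) h)"
    using linear_cmul[OF linear_frechet_derivative[OF assms]] by auto
  finally show ?thesis
    by (simp add: has_field_derivative_def)
qed

context
  fixes f :: "'a::euclidean_space \<Rightarrow> real" and x :: 'a
  assumes f: "twice_differentiable_at f x"
begin

text \<open>The sum over the basis is there because linearity of \<open>second_derivative\<close> in
  its first argument is only deduced from this lemma, by uniqueness of the derivative.\<close>

lemma has_derivative_frechet_derivative_Basis_sum:
  "((\<lambda>y. frechet_derivative f (at y) h) has_derivative
      (\<lambda>k. \<Sum>b\<in>Basis. (h \<bullet> b) * second_derivative f x b k)) (at x)"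
proof (rule has_derivative_transform_eventually)
  show "((\<lambda>y. \<Sum>b\<in>Basis. (h \<bullet> b) * frechet_derivative f (at y) b) has_derivative
      (\<lambda>k. \<Sum>b\<in>Basis. (h \<bullet> b) * second_derivative f x b k)) (at x)"
    unfolding second_derivative_def
    by (intro has_derivative_sum has_derivative_mult_right frechet_derivative_works[THEN iffD1])
       (use f in \<open>auto simp: twice_differentiable_at_def\<close>)
  have "\<forall>\<^sub>F y in nhds x. f differentiable (at y)"
    using f by (simp add: twice_differentiable_at_def)
  then show "\<forall>\<^sub>F y in at x. (\<Sum>b\<in>Basis. (h \<bullet> b) * frechet_derivative f (at y) b) =
      frechet_derivative f (at y) h"
    unfolding eventually_at_filter
    by eventually_elim (simp flip: frechet_derivative_Basis_sum)
  show "(\<Sum>b\<in>Basis. (h \<bullet> b) * frechet_derivative f (at x) b) = frechet_derivative f (at x) h"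
    using twice_differentiable_at_imp_differentiable[OF f]
    by (simp flip: frechet_derivative_Basis_sum)
qed simp

lemma second_derivative_Basis_sum:
  "second_derivative f x h k = (\<Sum>b\<in>Basis. (h \<bullet> b) * second_derivative f x b k)"
  unfolding second_derivative_def[of f x h]
  using fun_cong[OF frechet_derivative_at[OF has_derivative_frechet_derivative_Basis_sum[of h]], of k]
  by (rule sym)

lemma has_derivative_second_derivative:
  "((\<lambda>y. frechet_derivative f (at y) h) has_derivative second_derivative f x h) (at x)"
  using has_derivative_frechet_derivative_Basis_sum[of h]
  by (simp flip: second_derivative_Basis_sum)

lemma bounded_bilinear_second_derivative: "bounded_bilinear (second_derivative f x)"
  unfolding bilinear_conv_bounded_bilinear[symmetric] bilinear_def
proof (intro conjI allI)
  show "linear (second_derivative f x h)" for h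
    using has_derivative_second_derivative by (rule has_derivative_linear)
  show "linear (\<lambda>h. second_derivative f x h k)" for k
    by (subst second_derivative_Basis_sum)
       (auto intro!: linearI simp: inner_add_left algebra_simps sum.distrib sum_distrib_left)
qed

text \<open>Finitely many basis directions, each given the share \<open>e / DIM('a)\<close> of the
  error, yield one neighbourhood for all \<open>h\<close> by linearity. Taylor's formula below
  relies on this uniformity in \<open>h\<close>.\<close>

lemma frechet_derivative_expansion:
  assumes "e > 0"
  shows "\<forall>\<^sub>F y in nhds x. f differentiable (at y) \<and>
    (\<forall>h. \<bar>frechet_derivative f (at y) h - frechet_derivative f (at x) h
          - second_derivative f x h (y - x)\<bar> \<le> e * norm h * norm (y - x))"
proof -
  define e' where "e' = e / DIM('a)"
  have "e' > 0" using assms by (simp add: e'_def)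
  have "\<forall>\<^sub>F y in nhds x. \<bar>frechet_derivative f (at y) b - frechet_derivative f (at x) b
          - second_derivative f x b (y - x)\<bar> \<le> e' * norm (y - x)" for b
    using has_derivative_second_derivative[of b] \<open>e' > 0\<close>
    unfolding has_derivative_at_alt eventually_nhds_metric dist_norm by fastforce
  then have "\<forall>\<^sub>F y in nhds x. \<forall>b\<in>Basis. \<bar>frechet_derivative f (at y) b - frechet_derivative f (at x) b
          - second_derivative f x b (y - x)\<bar> \<le> e' * norm (y - x)"
    by (intro eventually_ball_finite) auto
  moreover have "\<forall>\<^sub>F y in nhds x. f differentiable (at y)"
    using f by (simp add: twice_differentiable_at_def)
  ultimately show ?thesis
  proof eventually_elim
    case (elim y)
    have "\<bar>frechet_derivative f (at y) h - frechet_derivative f (at x) h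
          - second_derivative f x h (y - x)\<bar> \<le> e * norm h * norm (y - x)" for h
    proof -
      have eq: "frechet_derivative f (at y) h - frechet_derivative f (at x) h
          - second_derivative f x h (y - x) = (\<Sum>b\<in>Basis. (h \<bullet> b) * (frechet_derivative f (at y) b
          - frechet_derivative f (at x) b - second_derivative f x b (y - x)))"
        using elim twice_differentiable_at_imp_differentiable[OF f]
        by (simp add: frechet_derivative_Basis_sum[of f _ h] second_derivative_Basis_sum[of h]
            sum_subtractf right_diff_distrib)
      have "\<bar>\<Sum>b\<in>Basis. (h \<bullet> b) * (frechet_derivative f (at y) b
          - frechet_derivative f (at x) b - second_derivative f x b (y - x))\<bar>
          \<le> (\<Sum>b\<in>(Basis::'a set). norm h * (e' * norm (y - x)))"
        by (rule order_trans[OF sum_abs], rule sum_mono)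
           (use elim in \<open>auto simp: abs_mult Basis_le_norm intro!: mult_mono\<close>)
      also have "\<dots> = e * norm h * norm (y - x)"
        by (simp add: e'_def)
      finally show ?thesis
        by (simp only: eq)
    qed
    with elim show ?case by blast
  qed
qed

text \<open>The mean value theorem on the segment from \<open>x\<close> to \<open>x + h\<close>
  reduces this to the expansion of the derivative. The filter is \<open>nhds 0\<close>, the quotient
  being 0 at \<open>h = 0\<close>, so that families hitting 0 may be substituted for
  \<open>h\<close>.\<close>

lemma taylor_second_order:
  "((\<lambda>h. (f (x + h) - f x - frechet_derivative f (at x) h - second_derivative f x h h / 2)
        / (norm h)\<^sup>2) \<longlongrightarrow> 0) (nhds 0)"
proof (rule tendstoI)
  fix e :: real assume "e > 0"
  interpret D2: bounded_bilinear "second_derivative f x" by (rule bounded_bilinear_second_derivative)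
  from frechet_derivative_expansion[of "e / 2"] \<open>e > 0\<close> obtain d where "d > 0" and
    d: "\<And>y. dist y x < d \<Longrightarrow> f differentiable (at y) \<and>
    (\<forall>h. \<bar>frechet_derivative f (at y) h - frechet_derivative f (at x) h
          - second_derivative f x h (y - x)\<bar> \<le> e / 2 * norm h * norm (y - x))"
    unfolding eventually_nhds_metric by auto
  have "\<bar>f (x + h) - f x - frechet_derivative f (at x) h - second_derivative f x h h / 2\<bar>
      \<le> e / 2 * (norm h)\<^sup>2" if "norm h < d" for h
  proof -
    have dist: "dist (x + s *\<^sub>R h) x < d" if "0 \<le> s" "s \<le> 1" for s
      using \<open>norm h < d\<close> that mult_left_le_one_le[of "norm h" s] by (simp add: dist_norm)
    \<comment> \<open>\<open>?g\<close> is \<open>f\<close> on the segment minus the linear and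
      quadratic Taylor terms, so \<open>?g 1 - ?g 0\<close> is the remainder to be bounded.\<close>
    let ?g = "\<lambda>s. f (x + s *\<^sub>R h) - s * frechet_derivative f (at x) h
        - s\<^sup>2 / 2 * second_derivative f x h h"
    have "\<exists>z. 0 < z \<and> z < 1 \<and> ?g 1 - ?g 0 = (1 - 0) * (frechet_derivative f (at (x + z *\<^sub>R h)) h
        - frechet_derivative f (at x) h - z * second_derivative f x h h)"
      by (rule MVT2) (use d dist in \<open>auto intro!: derivative_eq_intros has_field_derivative_along_line\<close>)
    then obtain z where z: "0 < z" "z < 1" and eq: "?g 1 - ?g 0 = frechet_derivative f (at (x + z *\<^sub>R h)) h
        - frechet_derivative f (at x) h - second_derivative f x h (x + z *\<^sub>R h - x)"
      by (auto simp: D2.scaleR_right)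
    have "\<bar>?g 1 - ?g 0\<bar> \<le> e / 2 * norm h * norm (x + z *\<^sub>R h - x)"
      unfolding eq using d[OF dist[of z]] z by auto
    also have "\<dots> \<le> e / 2 * norm h * norm h"
      using z \<open>e > 0\<close> by (intro mult_left_mono) (auto simp: mult_left_le_one_le)
    finally show ?thesis by (simp add: power2_eq_square algebra_simps)
  qed
  then have "dist ((f (x + h) - f x - frechet_derivative f (at x) h - second_derivative f x h h / 2)
        / (norm h)\<^sup>2) 0 < e" if "norm h < d" for h
    using that \<open>e > 0\<close> by (cases "h = 0") (force simp: divide_simps intro: le_less_trans)+
  then show "\<forall>\<^sub>F h in nhds 0. dist ((f (x + h) - f x - frechet_derivative f (at x) h
      - second_derivative f x h h / 2) / (norm h)\<^sup>2) 0 < e"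
    unfolding eventually_nhds_metric using \<open>d > 0\<close> by (auto simp: dist_norm)
qed

text \<open>One factor \<open>u\<close> comes from the mean value theorem in direction
  \<open>b\<close>, the other from subtracting the expansions of the derivative at two points that
  differ by \<open>u *\<^sub>R a\<close>. The numerator is symmetric in \<open>a\<close> and
  \<open>b\<close>, whence the symmetry of the second derivative.\<close>

lemma second_difference_tendsto:
  "((\<lambda>u. (f (x + u *\<^sub>R a + u *\<^sub>R b) - f (x + u *\<^sub>R a) - f (x + u *\<^sub>R b) + f x) / u\<^sup>2)
     \<longlongrightarrow> second_derivative f x b a) (at_right 0)"
proof (rule tendstoI)
  fix e :: real assume "e > 0"
  interpret D2: bounded_bilinear "second_derivative f x" by (rule bounded_bilinear_second_derivative)
  \<comment> \<open>The two expansion errors add up to \<open>u * e' * (C - 1)\<close>; the summand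
    1 keeps \<open>C\<close> positive.\<close>
  define C where "C = norm b * (norm a + 2 * norm b) + 1"
  have "C > 0" by (auto simp: C_def intro!: add_nonneg_pos)
  define e' where "e' = e / (2 * C)"
  have "e' > 0" using \<open>e > 0\<close> \<open>C > 0\<close> by (simp add: e'_def)
  from frechet_derivative_expansion[OF this] obtain d where "d > 0" and
    d: "\<And>y. dist y x < d \<Longrightarrow> f differentiable (at y) \<and>
    (\<forall>h. \<bar>frechet_derivative f (at y) h - frechet_derivative f (at x) h
          - second_derivative f x h (y - x)\<bar> \<le> e' * norm h * norm (y - x))"
    unfolding eventually_nhds_metric by auto
  \<comment> \<open>For \<open>u < d / N\<close> both segments used below stay in the ball of radius
    \<open>d\<close> around \<open>x\<close>.\<close>
  define N where "N = norm a + norm b + 1"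
  have "N > 0" by (auto simp: N_def intro!: add_nonneg_pos)
  have "dist ((f (x + u *\<^sub>R a + u *\<^sub>R b) - f (x + u *\<^sub>R a) - f (x + u *\<^sub>R b) + f x) / u\<^sup>2)
      (second_derivative f x b a) < e" if "0 < u" "u < d / N" for u
  proof -
    have uN: "u * norm a + u * norm b < d"
      using that \<open>N > 0\<close> by (simp add: field_simps N_def)
    have ua: "norm (u *\<^sub>R a + s *\<^sub>R b) \<le> u * norm a + u * norm b"
      and ub: "norm (s *\<^sub>R b) \<le> u * norm b" if "0 \<le> s" "s \<le> u" for s
      using that \<open>0 < u\<close> by (auto intro!: norm_triangle_mono mult_right_mono)
    have dist: "dist (x + u *\<^sub>R a + s *\<^sub>R b) x < d" "dist (x + s *\<^sub>R b) x < d" if "0 \<le> s" "s \<le> u" for s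
    proof -
      have "0 \<le> u * norm a" using \<open>0 < u\<close> by simp
      then show "dist (x + u *\<^sub>R a + s *\<^sub>R b) x < d" "dist (x + s *\<^sub>R b) x < d"
        using ua[OF that] ub[OF that] uN by (simp_all only: dist_norm add.assoc add_diff_cancel_left')
    qed
    \<comment> \<open>The difference of \<open>f\<close> along two parallel segments in direction
      \<open>b\<close>; its increment from 0 to \<open>u\<close> is the second difference.\<close>
    let ?g = "\<lambda>s. f (x + u *\<^sub>R a + s *\<^sub>R b) - f (x + s *\<^sub>R b)"
    have "\<exists>z. 0 < z \<and> z < u \<and> ?g u - ?g 0 = (u - 0) * (frechet_derivative f (at (x + u *\<^sub>R a + z *\<^sub>R b)) b
        - frechet_derivative f (at (x + z *\<^sub>R b)) b)"
      by (rule MVT2) (use d dist \<open>0 < u\<close> in \<open>auto intro!: derivative_eq_intros has_field_derivative_along_line\<close>)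
    then obtain z where z: "0 < z" "z < u" and eq: "?g u - ?g 0 = u * (frechet_derivative f (at (x + u *\<^sub>R a + z *\<^sub>R b)) b
        - frechet_derivative f (at (x + z *\<^sub>R b)) b)"
      by auto
    have "\<bar>frechet_derivative f (at (x + u *\<^sub>R a + z *\<^sub>R b)) b - frechet_derivative f (at x) b
          - second_derivative f x b (x + u *\<^sub>R a + z *\<^sub>R b - x)\<bar> \<le> e' * norm b * norm (x + u *\<^sub>R a + z *\<^sub>R b - x)"
      using d[OF dist(1)[of z]] z by auto
    also have "\<dots> \<le> e' * norm b * (u * norm a + u * norm b)"
      using ua[of z] z \<open>e' > 0\<close> by (intro mult_left_mono) (auto simp: add.assoc)
    finally have 1: "\<bar>frechet_derivative f (at (x + u *\<^sub>R a + z *\<^sub>R b)) b - frechet_derivative f (at x) b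
          - (u * second_derivative f x b a + second_derivative f x b (z *\<^sub>R b))\<bar>
          \<le> e' * norm b * (u * norm a + u * norm b)"
      by (simp add: D2.add_right D2.scaleR_right add.assoc)
    have "\<bar>frechet_derivative f (at (x + z *\<^sub>R b)) b - frechet_derivative f (at x) b
          - second_derivative f x b (x + z *\<^sub>R b - x)\<bar> \<le> e' * norm b * norm (x + z *\<^sub>R b - x)"
      using d[OF dist(2)[of z]] z by auto
    also have "\<dots> \<le> e' * norm b * (u * norm b)"
      using ub[of z] z \<open>e' > 0\<close> by (intro mult_left_mono) auto
    finally have 2: "\<bar>frechet_derivative f (at (x + z *\<^sub>R b)) b - frechet_derivative f (at x) b
          - second_derivative f x b (z *\<^sub>R b)\<bar> \<le> e' * norm b * (u * norm b)"
      by simp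
    have "\<bar>(?g u - ?g 0) / u - u * second_derivative f x b a\<bar>
        \<le> e' * norm b * (u * norm a + u * norm b) + e' * norm b * (u * norm b)"
      unfolding eq using \<open>0 < u\<close> 1 2 by simp
    also have "\<dots> = u * (e' * (C - 1))"
      by (simp add: C_def algebra_simps)
    also have "\<dots> < u * e"
      using \<open>0 < u\<close> \<open>C > 0\<close> \<open>e > 0\<close> by (intro mult_strict_left_mono) (auto simp: e'_def field_simps add_pos_pos)
    finally have "\<bar>(?g u - ?g 0) / u - u * second_derivative f x b a\<bar> / u < e"
      using \<open>0 < u\<close> by (simp add: field_simps)
    also have "\<bar>(?g u - ?g 0) / u - u * second_derivative f x b a\<bar> / u
        = \<bar>((?g u - ?g 0) / u - u * second_derivative f x b a) / u\<bar>"
      using \<open>0 < u\<close> by simp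
    also have "((?g u - ?g 0) / u - u * second_derivative f x b a) / u
        = (?g u - ?g 0) / u\<^sup>2 - second_derivative f x b a"
      using \<open>0 < u\<close> by (simp add: diff_divide_distrib power2_eq_square)
    finally show ?thesis
      by (simp add: dist_norm algebra_simps)
  qed
  then show "\<forall>\<^sub>F u in at_right 0. dist ((f (x + u *\<^sub>R a + u *\<^sub>R b) - f (x + u *\<^sub>R a) - f (x + u *\<^sub>R b) + f x) / u\<^sup>2)
      (second_derivative f x b a) < e"
    using eventually_at_right_real[of 0 "d / N"] \<open>d > 0\<close> \<open>N > 0\<close>
    by (auto elim!: eventually_mono)
qed

lemma second_derivative_commute: "second_derivative f x a b = second_derivative f x b a"
proof (rule tendsto_unique)
  show "((\<lambda>u. (f (x + u *\<^sub>R a + u *\<^sub>R b) - f (x + u *\<^sub>R a) - f (x + u *\<^sub>R b) + f x) / u\<^sup>2)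
     \<longlongrightarrow> second_derivative f x b a) (at_right 0)"
    by (rule second_difference_tendsto)
  show "((\<lambda>u. (f (x + u *\<^sub>R a + u *\<^sub>R b) - f (x + u *\<^sub>R a) - f (x + u *\<^sub>R b) + f x) / u\<^sup>2)
     \<longlongrightarrow> second_derivative f x a b) (at_right 0)"
    using second_difference_tendsto[of b a] by (simp add: algebra_simps)
qed simp

end

lemma tendsto_0_mult_Bfun:
  fixes f g :: "'z \<Rightarrow> real"
  assumes "(f \<longlongrightarrow> 0) F" "Bfun g F"
  shows "((\<lambda>z. f z * g z) \<longlongrightarrow> 0) F"
  using bounded_bilinear.Zfun_prod_Bfun[OF bounded_bilinear_mult] assms
  by (simp add: tendsto_Zfun_iff)

text \<open>The remainder at \<open>r z *\<^sub>R k z\<close> is multiplied by the bounded factor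
  \<open>(norm (k z))\<^sup>2\<close>. With an arbitrary filter and a bounded direction
  \<open>k\<close>, the formula serves both for a curve through \<open>x\<close> and for a family
  that is uniform over a compact set.\<close>

lemma taylor_second_order_scaled:
  fixes r :: "'z \<Rightarrow> real" and k :: "'z \<Rightarrow> 'a::euclidean_space"
  assumes f: "twice_differentiable_at f x"
    and r: "(r \<longlongrightarrow> 0) F" "\<forall>\<^sub>F z in F. r z \<noteq> 0" and k: "Bfun k F"
  shows "((\<lambda>z. (f (x + r z *\<^sub>R k z) - f x - r z * frechet_derivative f (at x) (k z)) / (r z)\<^sup>2
           - second_derivative f x (k z) (k z) / 2) \<longlongrightarrow> 0) F"
proof -
  interpret D2: bounded_bilinear "second_derivative f x"
    using f by (rule bounded_bilinear_second_derivative)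
  have lin: "linear (frechet_derivative f (at x))"
    using f by (intro linear_frechet_derivative twice_differentiable_at_imp_differentiable)
  let ?R = "\<lambda>h. (f (x + h) - f x - frechet_derivative f (at x) h - second_derivative f x h h / 2)
        / (norm h)\<^sup>2"
  have "((\<lambda>z. r z *\<^sub>R k z) \<longlongrightarrow> 0) F"
    using bounded_bilinear.Zfun_prod_Bfun[OF bounded_bilinear_scaleR] r(1) k
    by (simp add: tendsto_Zfun_iff)
  then have "((\<lambda>z. ?R (r z *\<^sub>R k z)) \<longlongrightarrow> 0) F"
    using taylor_second_order[OF f] by (rule filterlim_compose[rotated])
  moreover obtain C where "\<forall>\<^sub>F z in F. norm (k z) \<le> C"
    using k by (auto simp: Bfun_def)
  then have "Bfun (\<lambda>z. (norm (k z))\<^sup>2) F"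
    by (intro BfunI[where K = "C\<^sup>2"]) (auto elim!: eventually_mono intro: power_mono)
  ultimately have "((\<lambda>z. ?R (r z *\<^sub>R k z) * (norm (k z))\<^sup>2) \<longlongrightarrow> 0) F"
    by (rule tendsto_0_mult_Bfun)
  moreover have "\<forall>\<^sub>F z in F. ?R (r z *\<^sub>R k z) * (norm (k z))\<^sup>2 =
     (f (x + r z *\<^sub>R k z) - f x - r z * frechet_derivative f (at x) (k z)) / (r z)\<^sup>2
           - second_derivative f x (k z) (k z) / 2"
    using r(2)
  proof eventually_elim
    case (elim z)
    then show ?case
      by (cases "k z = 0")
        (auto simp: linear_0[OF lin] linear_cmul[OF lin] D2.scaleR_left D2.scaleR_right D2.zero_left
          field_simps power2_eq_square)
  qed
  ultimately show ?thesis
    by (rule Lim_transform_eventually)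
qed

section \<open>Diagonalising nondegenerate symmetric forms\<close>

text \<open>
  A maximal orthonormal set works: by maximality the form vanishes identically on its orthogonal
  complement, which by nondegeneracy must then be trivial.
\<close>

lemma ex_pm1_orthonormal_basis:
  fixes B :: "'a::euclidean_space \<Rightarrow> 'a \<Rightarrow> real"
  assumes "bounded_bilinear B" and sym: "\<And>v w. B v w = B w v"
    and nondeg: "\<And>v. v \<noteq> 0 \<Longrightarrow> \<exists>w. B v w \<noteq> 0"
  obtains S where "independent S" "span S = UNIV" "\<And>v. v \<in> S \<Longrightarrow> B v v \<in> {1, -1}"
    "\<And>v w. v \<in> S \<Longrightarrow> w \<in> S \<Longrightarrow> v \<noteq> w \<Longrightarrow> B v w = 0"
proof -
  interpret B: bounded_bilinear B by fact
  define orth where "orth S \<longleftrightarrow> (\<forall>v\<in>S. B v v \<in> {1, -1}) \<and> (\<forall>v\<in>S. \<forall>w\<in>S. v \<noteq> w \<longrightarrow> B v w = 0)" for S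
  have indep: "independent S" if S: "orth S" for S
    unfolding dependent_explicit
  proof clarify
    fix t u w assume t: "finite t" "t \<subseteq> S" "(\<Sum>v\<in>t. u v *\<^sub>R v) = 0" and w: "w \<in> t" "u w \<noteq> 0"
    have "0 = B (\<Sum>v\<in>t. u v *\<^sub>R v) w"
      using t by (simp add: B.zero_left)
    also have "\<dots> = (\<Sum>v\<in>t. u v * B v w)"
      by (simp add: B.sum_left B.scaleR_left)
    also have "\<dots> = (\<Sum>v\<in>t. if v = w then u w * B w w else 0)"
      using S t(2) w(1) by (intro sum.cong) (auto simp: orth_def)
    also have "\<dots> = u w * B w w"
      using t(1) w(1) by simp
    finally have "B w w = 0" using w by simp
    moreover have "B w w \<in> {1, -1}" using S t(2) w(1) by (auto simp: orth_def)
    ultimately show False by simp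
  qed
  have "orth {}" by (simp add: orth_def)
  \<comment> \<open>Independence bounds the cardinality by the dimension, so a largest such set
    exists.\<close>
  moreover have "\<forall>S. orth S \<longrightarrow> card S < DIM('a) + 1"
    using indep independent_bound by (metis Suc_eq_plus1 le_imp_less_Suc)
  ultimately obtain S where S: "orth S" and max: "\<And>S'. orth S' \<Longrightarrow> card S' \<le> card S"
    using ex_has_greatest_nat[of orth "{}" card] by blast
  have "finite S"
    using indep[OF S] independent_bound by blast
  \<comment> \<open>Projection along \<open>span S\<close> onto the vectors that are
    \<open>B\<close>-orthogonal to \<open>S\<close>.\<close>
  define P where "P x = x - (\<Sum>v\<in>S. (B x v / B v v) *\<^sub>R v)" for x
  have P: "B (P x) w = 0" if "w \<in> S" for x w
  proof -
    have "(\<Sum>v\<in>S. B x v / B v v * B v w) = (\<Sum>v\<in>S. if v = w then B x w else 0)"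
      using S that by (intro sum.cong) (auto simp: orth_def)
    also have "\<dots> = B x w"
      using \<open>finite S\<close> that by simp
    finally show ?thesis
      by (simp add: P_def B.diff_left B.sum_left B.scaleR_left)
  qed
  \<comment> \<open>Otherwise \<open>w\<close>, normalised, could be added to
    \<open>S\<close>.\<close>
  have isotropic: "B w w = 0" if w: "\<And>v. v \<in> S \<Longrightarrow> B w v = 0" for w
  proof (rule ccontr)
    assume nz: "B w w \<noteq> 0"
    define u where "u = (1 / sqrt \<bar>B w w\<bar>) *\<^sub>R w"
    have uu: "B u u = B w w / \<bar>B w w\<bar>"
      using nz by (simp add: u_def B.scaleR_left B.scaleR_right)
    have uv: "B u v = 0" "B v u = 0" if "v \<in> S" for v
      using w[OF that] sym by (simp_all add: u_def B.scaleR_left B.scaleR_right)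
    have "u \<notin> S"
      using uv(1)[of u] uu nz by auto
    moreover have "orth (insert u S)"
      using S uu uv nz by (auto simp: orth_def abs_if)
    ultimately show False
      using max[of "insert u S"] \<open>finite S\<close> by simp
  qed
  have "span S = UNIV"
  proof (rule ccontr)
    assume "span S \<noteq> UNIV"
    then obtain x where "x \<notin> span S" by blast
    have "P x \<noteq> 0"
    proof
      assume "P x = 0"
      then have "x = (\<Sum>v\<in>S. (B x v / B v v) *\<^sub>R v)" by (simp add: P_def)
      also have "\<dots> \<in> span S"
        by (intro span_sum span_scale span_base)
      finally show False using \<open>x \<notin> span S\<close> by simp
    qed
    then obtain z where "B (P x) z \<noteq> 0" using nondeg by blast
    \<comment> \<open>Polarisation: the quadratic form vanishes on the orthogonal complement, hence
      so does the bilinear form.\<close>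
    have "B (P x) (P z) = 0"
    proof -
      have "B (P x + P z) (P x + P z) = 0" "B (P x) (P x) = 0" "B (P z) (P z) = 0"
        by (rule isotropic, simp add: P B.add_left)+
      then show ?thesis
        using sym[of "P z" "P x"] by (simp add: B.add_left B.add_right)
    qed
    moreover have "B (P x) (P z + (\<Sum>v\<in>S. (B z v / B v v) *\<^sub>R v)) =
        B (P x) (P z) + (\<Sum>v\<in>S. (B z v / B v v) * B (P x) v)"
      by (simp add: B.add_right B.sum_right B.scaleR_right)
    moreover have "P z + (\<Sum>v\<in>S. (B z v / B v v) *\<^sub>R v) = z"
      by (simp add: P_def)
    ultimately show False
      using \<open>B (P x) z \<noteq> 0\<close> by (simp add: P)
  qed
  with S indep[OF S] that show thesis
    by (auto simp: orth_def)
qed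

section \<open>Uniform convergence as convergence along a product filter\<close>

lemma eventually_prod_principal:
  "(\<forall>\<^sub>F z in F \<times>\<^sub>F principal K. P z) \<longleftrightarrow> (\<forall>\<^sub>F t in F. \<forall>x\<in>K. P (t, x))"
  unfolding eventually_prod_filter eventually_principal
proof safe
  fix Q R assume "\<forall>\<^sub>F t in F. Q t" "\<forall>x\<in>K. R x" "\<forall>t x. Q t \<longrightarrow> R x \<longrightarrow> P (t, x)"
  then show "\<forall>\<^sub>F t in F. \<forall>x\<in>K. P (t, x)"
    by (auto elim: eventually_mono)
next
  assume "\<forall>\<^sub>F t in F. \<forall>x\<in>K. P (t, x)"
  then show "\<exists>Q R. (\<forall>\<^sub>F t in F. Q t) \<and> (\<forall>x\<in>K. R x) \<and> (\<forall>t x. Q t \<longrightarrow> R x \<longrightarrow> P (t, x))"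
    by (intro exI[of _ "\<lambda>t. \<forall>x\<in>K. P (t, x)"] exI[of _ "\<lambda>x. x \<in> K"]) auto
qed

text \<open>This makes the ordinary limit rules for sums, products and quotients available for
  uniform convergence.\<close>

lemma uniform_limit_iff_tendsto_prod_principal:
  "uniform_limit K f l F \<longleftrightarrow>
     ((\<lambda>z. dist (f (fst z) (snd z)) (l (snd z))) \<longlongrightarrow> 0) (F \<times>\<^sub>F principal K)"
  by (simp add: uniform_limit_iff tendsto_iff eventually_prod_principal)

lemma tendsto_imp_Bfun:
  fixes f :: "'z \<Rightarrow> 'a::real_normed_vector"
  assumes "(f \<longlongrightarrow> l) F"
  shows "Bfun f F"
proof (rule BfunI)
  show "\<forall>\<^sub>F z in F. norm (f z) \<le> norm l + 1"
    using tendstoD[OF assms zero_less_one]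
  proof eventually_elim
    case (elim z)
    then show ?case
      using norm_triangle_sub[of "f z" l] by (simp add: dist_norm)
  qed
qed

lemma Bfun_prod_principal_continuous:
  fixes g :: "'b::topological_space \<Rightarrow> 'a::real_normed_vector"
  assumes "continuous_on K g" "compact K"
  shows "Bfun (\<lambda>z. g (snd z)) (F \<times>\<^sub>F principal K)"
proof -
  obtain C where "\<And>x. x \<in> K \<Longrightarrow> norm (g x) \<le> C"
    using compact_imp_bounded[OF compact_continuous_image[OF assms]]
    by (auto simp: bounded_iff)
  then show ?thesis
    by (intro BfunI[where K = C]) (auto simp: eventually_prod_principal)
qed

text \<open>The exponential is not uniformly continuous, but \<open>s\<close> is bounded on
  \<open>K\<close>: the difference factors as \<open>(exp (- (S - s)) - 1) * exp (- s)\<close>,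
  where the first factor tends to 0 and the second is bounded.\<close>

lemma uniform_limit_exp_uminus:
  fixes s :: "'b::topological_space \<Rightarrow> real"
  assumes "uniform_limit K S s F" "continuous_on K s" "compact K"
  shows "uniform_limit K (\<lambda>t x. exp (- S t x)) (\<lambda>x. exp (- s x)) F"
proof -
  let ?F = "F \<times>\<^sub>F principal K"
  have "((\<lambda>z. S (fst z) (snd z) - s (snd z)) \<longlongrightarrow> 0) ?F"
    using assms(1) unfolding uniform_limit_iff_tendsto_prod_principal dist_norm
    by (rule tendsto_norm_zero_cancel)
  then have "((\<lambda>z. exp (- (S (fst z) (snd z) - s (snd z))) - 1) \<longlongrightarrow> exp (- 0) - 1) ?F"
    by (intro tendsto_intros)
  then have "((\<lambda>z. (exp (- (S (fst z) (snd z) - s (snd z))) - 1) * exp (- s (snd z))) \<longlongrightarrow> 0) ?F"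
    using assms(2,3) by (intro tendsto_0_mult_Bfun Bfun_prod_principal_continuous continuous_intros) auto
  moreover have "(exp (- (a - b)) - 1) * exp (- b) = exp (- a) - exp (- b)" for a b :: real
    by (simp add: left_diff_distrib flip: exp_add)
  ultimately show ?thesis
    unfolding uniform_limit_iff_tendsto_prod_principal dist_norm
    by (intro tendsto_norm_zero) simp
qed

section \<open>Anisotropic rescaling\<close>

text \<open>Here \<open>w\<close> carries the tangential coordinates and \<open>l\<close> the
  coordinate scaled along \<open>\<theta>\<close>. The clause on \<open>H t x = 0\<close> turns into
  invertibility once \<open>w\<close> and \<open>l\<close> have no common kernel; it holds
  eventually, as the construction divides by a quantity known to be nonzero only for large
  \<open>t\<close>.\<close>

lemma anisotropic_rescaling:
  fixes q :: "'i \<Rightarrow> 'a::euclidean_space \<Rightarrow> real" and w :: "'b::euclidean_space \<Rightarrow> 'a" and l :: "'b \<Rightarrow> real"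
  assumes "finite I" "j \<in> I" and p: "p j > 0" "\<And>i. i \<in> I \<Longrightarrow> i \<noteq> j \<Longrightarrow> p i < p j"
    and q: "\<And>i. i \<in> I \<Longrightarrow> twice_differentiable_at (q i) \<theta>"
    and D\<theta>: "frechet_derivative (q j) (at \<theta>) \<theta> \<noteq> 0"
    and w: "linear w" "\<And>x. frechet_derivative (q j) (at \<theta>) (w x) = 0" and l: "linear l"
  obtains H :: "real \<Rightarrow> 'b \<Rightarrow> 'a" where
    "\<forall>\<^sub>F t in at_top. linear (H t) \<and> (\<forall>x. H t x = 0 \<longrightarrow> w x = 0 \<and> l x = 0)"
    "\<And>K. compact K \<Longrightarrow> uniform_limit K (\<lambda>t x. \<Sum>i\<in>I. t powr p i * (q i (\<theta> + H t x) - q i \<theta>))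
       (\<lambda>x. l x + second_derivative (q j) \<theta> (w x) (w x) / 2) at_top"
proof -
  \<comment> \<open>The differential at \<open>t\<theta>\<close> of the sum, rescaled; \<open>h\<close> is chosen so that it maps \<open>h t x\<close> to \<open>t\<^bsup>-p j\<^esup> l x\<close>.\<close>
  define g where "g t y = (\<Sum>i\<in>I. t powr (p i - p j) * frechet_derivative (q i) (at \<theta>) y)" for t y
  define h where "h t x = t powr (- p j / 2) *\<^sub>R
      (w x + ((t powr (- p j / 2) * l x - g t (w x)) / g t \<theta>) *\<^sub>R \<theta>)" for t x
  have lin: "linear (frechet_derivative (q i) (at \<theta>))" if "i \<in> I" for i
    using q[OF that] by (intro linear_frechet_derivative twice_differentiable_at_imp_differentiable)
  \<comment> \<open>The divisor in \<open>h\<close> has a nonzero limit: every term with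
    \<open>i \<noteq> j\<close> carries a negative power of \<open>t\<close>.\<close>
  have "((\<lambda>t. g t \<theta>) \<longlongrightarrow> (\<Sum>i\<in>I. if i = j then frechet_derivative (q j) (at \<theta>) \<theta> else 0)) at_top"
    unfolding g_def
  proof (rule tendsto_sum)
    fix i assume "i \<in> I"
    show "((\<lambda>t. t powr (p i - p j) * frechet_derivative (q i) (at \<theta>) \<theta>) \<longlongrightarrow>
        (if i = j then frechet_derivative (q j) (at \<theta>) \<theta> else 0)) at_top"
    proof (cases "i = j")
      case True
      then show ?thesis
        by (auto intro!: tendsto_eventually eventually_mono[OF eventually_gt_at_top[of 0]])
    next
      case False
      then show ?thesis
        using p(2)[OF \<open>i \<in> I\<close>] by (auto intro!: tendsto_mult_left_zero tendsto_neg_powr filterlim_ident)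
    qed
  qed
  then have g\<theta>: "((\<lambda>t. g t \<theta>) \<longlongrightarrow> frechet_derivative (q j) (at \<theta>) \<theta>) at_top"
    using \<open>finite I\<close> \<open>j \<in> I\<close> by simp
  have ev_g: "\<forall>\<^sub>F t in at_top. g t \<theta> \<noteq> 0"
    using tendsto_imp_eventually_ne[OF g\<theta> D\<theta>] .
  have unif: "uniform_limit K (\<lambda>t x. \<Sum>i\<in>I. t powr p i * (q i (\<theta> + h t x) - q i \<theta>))
           (\<lambda>x. l x + second_derivative (q j) \<theta> (w x) (w x) / 2) at_top" if K: "compact K" for K
  proof -
    \<comment> \<open>Limits along \<open>F\<close> are limits for \<open>t\<close> tending to
      infinity, uniform in \<open>x \<in> K\<close>.\<close>
    define F where "F = (at_top :: real filter) \<times>\<^sub>F principal K"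
    have fst: "filterlim fst at_top F"
      unfolding F_def by (rule filterlim_fst)
    have contw: "continuous_on K w" and contl: "continuous_on K l"
      using w(1) l by (auto simp: linear_continuous_on linear_conv_bounded_linear)
    have powr0: "((\<lambda>z. fst z powr a) \<longlongrightarrow> 0) F" if "a < 0" for a
      by (rule tendsto_neg_powr[OF that fst])
    have pos: "\<forall>\<^sub>F z in F. fst z > 0"
      using fst by (auto simp: filterlim_at_top_dense)
    have g\<theta>F: "((\<lambda>z. g (fst z) \<theta>) \<longlongrightarrow> frechet_derivative (q j) (at \<theta>) \<theta>) F"
      by (rule filterlim_compose[OF g\<theta> fst])
    have gnzF: "\<forall>\<^sub>F z in F. g (fst z) \<theta> \<noteq> 0"
      using tendsto_imp_eventually_ne[OF g\<theta>F D\<theta>] .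
    have Bw: "Bfun (\<lambda>z. w (snd z)) F" and Bl: "Bfun (\<lambda>z. l (snd z)) F"
      unfolding F_def by (intro Bfun_prod_principal_continuous contw contl K)+
    \<comment> \<open>The term \<open>i = j\<close> is zero because \<open>w\<close> maps into the
      kernel of the differential of \<open>q j\<close>; the others carry negative powers of
      \<open>t\<close>.\<close>
    have "((\<lambda>z. g (fst z) (w (snd z))) \<longlongrightarrow> (\<Sum>i\<in>I. 0)) F"
      unfolding g_def
    proof (rule tendsto_sum)
      fix i assume i: "i \<in> I"
      show "((\<lambda>z. fst z powr (p i - p j) * frechet_derivative (q i) (at \<theta>) (w (snd z))) \<longlongrightarrow> 0) F"
      proof (cases "i = j")
        case False
        have "continuous_on K (\<lambda>x. frechet_derivative (q i) (at \<theta>) (w x))"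
          by (rule linear_continuous_on_compose[OF contw lin[OF i]])
        then show ?thesis
          using p(2)[OF i False] K unfolding F_def
          by (intro tendsto_0_mult_Bfun powr0[unfolded F_def] Bfun_prod_principal_continuous) auto
      qed (simp add: w(2))
    qed
    then have gw: "((\<lambda>z. g (fst z) (w (snd z))) \<longlongrightarrow> 0) F" by simp
    \<comment> \<open>The displacement is \<open>r z *\<^sub>R k z\<close>, where \<open>k\<close>
      differs from \<open>w\<close> by \<open>\<rho>\<close> times \<open>\<theta>\<close> and
      \<open>\<rho>\<close> tends to 0 uniformly on \<open>K\<close>.\<close>
    define r where "r z = fst z powr (- p j / 2)" for z :: "real \<times> 'b"
    define \<rho> where "\<rho> z = (r z * l (snd z) - g (fst z) (w (snd z))) / g (fst z) \<theta>" for z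
    define k where "k z = w (snd z) + \<rho> z *\<^sub>R \<theta>" for z
    have hk: "h (fst z) (snd z) = r z *\<^sub>R k z" for z
      by (simp add: h_def r_def k_def \<rho>_def)
    have r0: "(r \<longlongrightarrow> 0) F"
      unfolding r_def using p(1) by (intro powr0) simp
    have rnz: "\<forall>\<^sub>F z in F. r z \<noteq> 0"
      using pos by eventually_elim (simp add: r_def)
    have "((\<lambda>z. r z * l (snd z)) \<longlongrightarrow> 0) F"
      by (intro tendsto_0_mult_Bfun r0 Bl)
    from tendsto_divide[OF tendsto_diff[OF this gw] g\<theta>F D\<theta>]
    have \<rho>0: "(\<rho> \<longlongrightarrow> 0) F"
      by (simp add: \<rho>_def[abs_def])
    have Bk: "Bfun k F"
    proof -
      obtain C where "\<forall>\<^sub>F z in F. norm (w (snd z)) \<le> C"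
        using Bw by (auto simp: Bfun_def)
      moreover have "\<forall>\<^sub>F z in F. dist (\<rho> z) 0 < 1"
        using \<rho>0 by (rule tendstoD) simp
      ultimately have "\<forall>\<^sub>F z in F. norm (k z) \<le> C + norm \<theta>"
      proof eventually_elim
        case (elim z)
        have "norm (\<rho> z *\<^sub>R \<theta>) \<le> norm \<theta>"
          using elim(2) by (simp add: mult_left_le_one_le)
        then show ?case
          unfolding k_def using elim(1) norm_triangle_mono by blast
      qed
      then show ?thesis by (rule BfunI)
    qed
    \<comment> \<open>Three errors will remain: \<open>E\<close> from Taylor's formula,
      \<open>G\<close> from replacing \<open>k\<close> by \<open>w\<close> in the quadratic terms,
      and the quadratic terms with \<open>i \<noteq> j\<close>, which are suppressed by
      \<open>t powr (p i - p j)\<close>.\<close>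
    define E where "E i z = (q i (\<theta> + r z *\<^sub>R k z) - q i \<theta> - r z * frechet_derivative (q i) (at \<theta>) (k z)) / (r z)\<^sup>2
           - second_derivative (q i) \<theta> (k z) (k z) / 2" for i z
    have E: "(E i \<longlongrightarrow> 0) F" if "i \<in> I" for i
      unfolding E_def using that by (intro taylor_second_order_scaled q r0 rnz Bk)
    define G where "G i z = second_derivative (q i) \<theta> (k z) (k z)
        - second_derivative (q i) \<theta> (w (snd z)) (w (snd z))" for i z
    have G: "(G i \<longlongrightarrow> 0) F" and cont2: "continuous_on K (\<lambda>x. second_derivative (q i) \<theta> (w x) (w x))"
      if "i \<in> I" for i
    proof -
      interpret D2: bounded_bilinear "second_derivative (q i) \<theta>"
        using q[OF that] by (rule bounded_bilinear_second_derivative)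
      show "continuous_on K (\<lambda>x. second_derivative (q i) \<theta> (w x) (w x))"
        by (intro D2.continuous_on contw)
      have eq: "G i z = \<rho> z * second_derivative (q i) \<theta> \<theta> (w (snd z))
          + \<rho> z * second_derivative (q i) \<theta> (w (snd z)) \<theta>
          + \<rho> z * \<rho> z * second_derivative (q i) \<theta> \<theta> \<theta>" for z
        by (simp add: G_def k_def D2.add_left D2.add_right D2.scaleR_left D2.scaleR_right distrib_left)
      have "((\<lambda>z. \<rho> z * second_derivative (q i) \<theta> \<theta> (w (snd z))) \<longlongrightarrow> 0) F"
        "((\<lambda>z. \<rho> z * second_derivative (q i) \<theta> (w (snd z)) \<theta>) \<longlongrightarrow> 0) F"
        unfolding F_def
        by (intro tendsto_0_mult_Bfun \<rho>0[unfolded F_def] Bfun_prod_principal_continuous K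
            D2.continuous_on contw continuous_on_const)+
      moreover have "((\<lambda>z. \<rho> z * \<rho> z * second_derivative (q i) \<theta> \<theta> \<theta>) \<longlongrightarrow> 0) F"
        by (auto intro!: tendsto_eq_intros \<rho>0)
      ultimately have "((\<lambda>z. \<rho> z * second_derivative (q i) \<theta> \<theta> (w (snd z))
          + \<rho> z * second_derivative (q i) \<theta> (w (snd z)) \<theta>
          + \<rho> z * \<rho> z * second_derivative (q i) \<theta> \<theta> \<theta>) \<longlongrightarrow> 0 + 0 + 0) F"
        by (intro tendsto_add)
      then show "(G i \<longlongrightarrow> 0) F" by (simp add: eq[abs_def])
    qed
    have "((\<lambda>z. \<Sum>i\<in>I. fst z powr (p i - p j) * (E i z + G i z / 2 +
             (if i = j then 0 else second_derivative (q i) \<theta> (w (snd z)) (w (snd z)) / 2))) \<longlongrightarrow> (\<Sum>i\<in>I. 0)) F"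
    proof (rule tendsto_sum)
      fix i assume i: "i \<in> I"
      have EG: "((\<lambda>z. E i z + G i z / 2) \<longlongrightarrow> 0) F"
        using E[OF i] G[OF i] by (auto intro!: tendsto_eq_intros)
      show "((\<lambda>z. fst z powr (p i - p j) * (E i z + G i z / 2 +
             (if i = j then 0 else second_derivative (q i) \<theta> (w (snd z)) (w (snd z)) / 2))) \<longlongrightarrow> 0) F"
      proof (cases "i = j")
        case True
        have "\<forall>\<^sub>F z in F. E i z + G i z / 2 = fst z powr (p i - p j) * (E i z + G i z / 2 +
             (if i = j then 0 else second_derivative (q i) \<theta> (w (snd z)) (w (snd z)) / 2))"
          using pos by eventually_elim (simp add: True)
        with EG show ?thesis by (rule Lim_transform_eventually)
      next
        case False
        have pi: "((\<lambda>z. fst z powr (p i - p j)) \<longlongrightarrow> 0) F"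
          using p(2)[OF i False] by (intro powr0) simp
        have "((\<lambda>z. fst z powr (p i - p j) * (second_derivative (q i) \<theta> (w (snd z)) (w (snd z)))) \<longlongrightarrow> 0) F"
          unfolding F_def using i
          by (intro tendsto_0_mult_Bfun pi[unfolded F_def] Bfun_prod_principal_continuous K cont2)
        then have "((\<lambda>z. fst z powr (p i - p j) * (E i z + G i z / 2)
            + fst z powr (p i - p j) * (second_derivative (q i) \<theta> (w (snd z)) (w (snd z))) / 2) \<longlongrightarrow> 0 * 0 + 0 / 2) F"
          by (intro tendsto_intros pi EG) simp_all
        then show ?thesis using False by (simp add: distrib_left)
      qed
    qed
    then have lim0: "((\<lambda>z. \<Sum>i\<in>I. fst z powr (p i - p j) * (E i z + G i z / 2 +
             (if i = j then 0 else second_derivative (q i) \<theta> (w (snd z)) (w (snd z)) / 2))) \<longlongrightarrow> 0) F"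
      by simp
    have "((\<lambda>z. (\<Sum>i\<in>I. fst z powr p i * (q i (\<theta> + h (fst z) (snd z)) - q i \<theta>)) -
        (l (snd z) + second_derivative (q j) \<theta> (w (snd z)) (w (snd z)) / 2)) \<longlongrightarrow> 0) F"
      using lim0
    proof (rule Lim_transform_eventually)
      show "\<forall>\<^sub>F z in F. (\<Sum>i\<in>I. fst z powr (p i - p j) * (E i z + G i z / 2 +
             (if i = j then 0 else second_derivative (q i) \<theta> (w (snd z)) (w (snd z)) / 2))) =
        (\<Sum>i\<in>I. fst z powr p i * (q i (\<theta> + h (fst z) (snd z)) - q i \<theta>)) -
        (l (snd z) + second_derivative (q j) \<theta> (w (snd z)) (w (snd z)) / 2)"
        using pos gnzF rnz
      proof eventually_elim
        case (elim z)
        have r2: "(r z)\<^sup>2 = fst z powr (- p j)" and r1: "r z * r z = fst z powr (- p j)"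
          by (simp_all add: r_def power2_eq_square flip: powr_add)
        \<comment> \<open>The coefficient \<open>\<rho>\<close> was chosen for this. The first-order
          terms of all \<open>q i\<close> together are \<open>t powr p j * r z * g t (k z)\<close>
          with \<open>t = fst z\<close>; as \<open>r z * r z\<close> is
          \<open>t powr (- p j)\<close>, they equal \<open>l\<close> exactly and not only in the
          limit.\<close>
        have gk: "g (fst z) (k z) = r z * l (snd z)"
        proof -
          have "g (fst z) (k z) = g (fst z) (w (snd z)) + \<rho> z * g (fst z) \<theta>"
            unfolding g_def k_def sum_distrib_left sum.distrib[symmetric]
            by (intro sum.cong) (auto simp: linear_add[OF lin] linear_cmul[OF lin] algebra_simps)
          then show ?thesis
            using elim by (simp add: \<rho>_def)
        qed
        have summand: "fst z powr p i * (q i (\<theta> + h (fst z) (snd z)) - q i \<theta>) =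
            fst z powr p j * r z * (fst z powr (p i - p j) * frechet_derivative (q i) (at \<theta>) (k z))
            + (fst z powr (p i - p j) * (E i z + G i z / 2 +
             (if i = j then 0 else second_derivative (q i) \<theta> (w (snd z)) (w (snd z)) / 2))
            + (if i = j then second_derivative (q i) \<theta> (w (snd z)) (w (snd z)) / 2 else 0))" for i
        proof -
          have "q i (\<theta> + r z *\<^sub>R k z) - q i \<theta> = r z * frechet_derivative (q i) (at \<theta>) (k z)
              + (r z)\<^sup>2 * (E i z + second_derivative (q i) \<theta> (k z) (k z) / 2)"
            using elim by (simp add: E_def)
          moreover have powr_split: "fst z powr p i = fst z powr p j * fst z powr (p i - p j)"
            and "fst z powr p i * (r z)\<^sup>2 = fst z powr (p i - p j)"
            by (simp_all add: r2 flip: powr_add)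
          moreover have "a * (b * d + b\<^sup>2 * x) = a * b * d + a * b\<^sup>2 * x" for a b d x :: real
            by (simp add: algebra_simps)
          ultimately have "fst z powr p i * (q i (\<theta> + h (fst z) (snd z)) - q i \<theta>) =
            fst z powr p i * r z * frechet_derivative (q i) (at \<theta>) (k z)
            + fst z powr (p i - p j) * (E i z + second_derivative (q i) \<theta> (k z) (k z) / 2)"
            by (simp only: hk)
          then have "fst z powr p i * (q i (\<theta> + h (fst z) (snd z)) - q i \<theta>) =
            fst z powr p j * r z * (fst z powr (p i - p j) * frechet_derivative (q i) (at \<theta>) (k z))
            + fst z powr (p i - p j) * (E i z + second_derivative (q i) \<theta> (k z) (k z) / 2)"
            using powr_split by (simp add: mult_ac)
          then show ?thesis
            using elim by (auto simp: G_def algebra_simps add_divide_distrib diff_divide_distrib)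
        qed
        have "fst z powr p j * r z * (r z * l (snd z)) = l (snd z)"
          using elim by (simp add: mult.assoc[symmetric]) (simp add: mult.assoc r1 flip: powr_add)
        then have "(\<Sum>i\<in>I. fst z powr p j * r z *
            (fst z powr (p i - p j) * frechet_derivative (q i) (at \<theta>) (k z))) = l (snd z)"
          using gk unfolding g_def by (simp flip: sum_distrib_left)
        then show ?case
          unfolding summand sum.distrib using \<open>finite I\<close> \<open>j \<in> I\<close> by simp
      qed
    qed
    then show ?thesis
      unfolding uniform_limit_iff_tendsto_prod_principal F_def dist_norm
      by (rule tendsto_norm_zero)
  qed
  have lin_g: "linear (g t)" for t
    unfolding g_def
    by (intro linearI)
      (auto simp: linear_add[OF lin] linear_cmul[OF lin] sum_distrib_left sum.distrib algebra_simps
        intro!: sum.cong)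
  have "\<forall>\<^sub>F t in at_top. linear (h t) \<and> (\<forall>x. h t x = 0 \<longrightarrow> w x = 0 \<and> l x = 0)"
    using ev_g eventually_gt_at_top[of 0]
  proof eventually_elim
    case (elim t)
    have "linear (h t)"
      unfolding h_def
      by (intro linearI)
        (simp_all add: linear_add[OF w(1)] linear_cmul[OF w(1)] linear_add[OF l] linear_cmul[OF l]
          linear_add[OF lin_g] linear_cmul[OF lin_g] algebra_simps add_divide_distrib diff_divide_distrib)
    moreover have "w x = 0 \<and> l x = 0" if "h t x = 0" for x
    proof -
      define \<rho> where "\<rho> = (t powr (- p j / 2) * l x - g t (w x)) / g t \<theta>"
      have eq: "w x + \<rho> *\<^sub>R \<theta> = 0"
        using that elim by (simp add: h_def \<rho>_def)
      \<comment> \<open>The differential of \<open>q j\<close> vanishes on the range of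
        \<open>w\<close> but not at \<open>\<theta>\<close>, so it isolates \<open>\<rho>\<close>.
        With \<open>\<rho> = 0\<close> and \<open>w x = 0\<close>, the numerator of
        \<open>\<rho>\<close> gives \<open>l x = 0\<close>.\<close>
      have "frechet_derivative (q j) (at \<theta>) (w x + \<rho> *\<^sub>R \<theta>) = \<rho> * frechet_derivative (q j) (at \<theta>) \<theta>"
        using \<open>j \<in> I\<close> by (simp add: linear_add[OF lin] linear_cmul[OF lin] w(2))
      then have "\<rho> = 0"
        using D\<theta> \<open>j \<in> I\<close> by (simp add: eq linear_0[OF lin])
      with eq have "w x = 0" by simp
      then show ?thesis
        using \<open>\<rho> = 0\<close> elim by (simp add: \<rho>_def linear_0[OF lin_g])
    qed
    ultimately show ?case by blast
  qed
  with unif that show thesis by blast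
qed

section \<open>Curvature of the level set\<close>

text \<open>Euler's identity: both sides are the derivative of \<open>q\<close> along the ray
  through \<open>\<theta>\<close>, taken at \<open>\<alpha> = 1\<close>.\<close>

lemma euler_homogeneous:
  fixes q :: "'a::euclidean_space \<Rightarrow> real"
  assumes "q differentiable (at \<theta>)" and "\<And>\<alpha>. \<alpha> \<ge> 0 \<Longrightarrow> q (\<alpha> *\<^sub>R \<theta>) = \<alpha> powr p * q \<theta>"
  shows "frechet_derivative q (at \<theta>) \<theta> = p * q \<theta>"
proof (rule DERIV_unique)
  show "((\<lambda>\<alpha>. q (\<alpha> *\<^sub>R \<theta>)) has_field_derivative frechet_derivative q (at \<theta>) \<theta>) (at 1)"
    using has_field_derivative_along_line[of q 0 1 \<theta>] assms(1) by simp
  have "((\<lambda>\<alpha>. \<alpha> powr p * q \<theta>) has_field_derivative p * q \<theta>) (at 1)"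
    by (auto intro!: derivative_eq_intros)
  moreover have "\<forall>\<^sub>F \<alpha> in nhds 1. \<alpha> powr p * q \<theta> = q (\<alpha> *\<^sub>R \<theta>)"
    using eventually_nhds_in_open[of "{0<..}" "1::real"] assms(2) by (auto elim!: eventually_mono)
  ultimately show "((\<lambda>\<alpha>. q (\<alpha> *\<^sub>R \<theta>)) has_field_derivative p * q \<theta>) (at 1)"
    by (simp add: DERIV_cong_ev[OF refl _ refl])
qed

text \<open>Both identities compare the coefficients of the Taylor expansion of \<open>g\<close> along the curve \<open>u \<mapsto> x + L (u b, \<psi> (u b))\<close>.\<close>

lemma second_derivative_on_level_set_graph:
  fixes g :: "'a::euclidean_space \<Rightarrow> real" and \<psi> :: "'b::euclidean_space \<Rightarrow> real"
  assumes g: "twice_differentiable_at g x" and \<psi>: "twice_differentiable_at \<psi> 0"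
    and \<psi>0: "\<psi> 0 = 0" "(\<psi> has_derivative (\<lambda>_. 0)) (at 0)"
    and L: "linear L"
    and graph: "\<forall>\<^sub>F y in nhds 0. g (x + L (y, \<psi> y)) = g x"
  shows "frechet_derivative g (at x) (L (b, 0)) = 0" (is "?D (L (b, 0)) = 0")
    and "second_derivative g x (L (b, 0)) (L (b, 0)) =
      - frechet_derivative g (at x) (L (0, 1)) * second_derivative \<psi> 0 b b"
proof -
  interpret D2: bounded_bilinear "second_derivative g x"
    using g by (rule bounded_bilinear_second_derivative)
  have lin: "linear ?D"
    using g by (intro linear_frechet_derivative twice_differentiable_at_imp_differentiable)
  have D\<psi>: "frechet_derivative \<psi> (at 0) = (\<lambda>_. 0)"
    using frechet_derivative_at[OF \<psi>0(2)] by simp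
  have nz: "\<forall>\<^sub>F u in at (0::real). u \<noteq> 0"
    by (simp add: eventually_at_filter)
  have \<psi>2: "((\<lambda>u. \<psi> (u *\<^sub>R b) / u\<^sup>2) \<longlongrightarrow> second_derivative \<psi> 0 b b / 2) (at 0)"
    using taylor_second_order_scaled[OF \<psi> tendsto_ident_at nz Bfun_const[of b]]
    by (simp add: D\<psi> \<psi>0 LIM_zero_iff)
  have \<psi>1: "((\<lambda>u. \<psi> (u *\<^sub>R b) / u) \<longlongrightarrow> 0) (at 0)"
  proof (rule Lim_transform_eventually)
    show "((\<lambda>u. u * (\<psi> (u *\<^sub>R b) / u\<^sup>2)) \<longlongrightarrow> 0) (at 0)"
      using tendsto_mult[OF tendsto_ident_at \<psi>2] by simp
    show "\<forall>\<^sub>F u in at 0. u * (\<psi> (u *\<^sub>R b) / u\<^sup>2) = \<psi> (u *\<^sub>R b) / u"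
      using nz by eventually_elim (simp add: power2_eq_square)
  qed
  \<comment> \<open>The curve is \<open>x + u *\<^sub>R k u\<close>, and \<open>k\<close> tends to
    the tangent direction \<open>L (b, 0)\<close>.\<close>
  define k where "k u = L (b, \<psi> (u *\<^sub>R b) / u)" for u
  have "bounded_linear L"
    using L by (simp add: linear_conv_bounded_linear)
  then have k: "(k \<longlongrightarrow> L (b, 0)) (at 0)"
    unfolding k_def by (intro bounded_linear.tendsto[of L] tendsto_Pair tendsto_const \<psi>1)
  then have "Bfun k (at 0)"
    by (rule tendsto_imp_Bfun)
  have uk: "u *\<^sub>R k u = L (u *\<^sub>R b, \<psi> (u *\<^sub>R b))" if "u \<noteq> 0" for u
    using that by (simp add: k_def linear_cmul[OF L, symmetric])
  have Dk: "?D (k u) = ?D (L (b, 0)) + \<psi> (u *\<^sub>R b) / u * ?D (L (0, 1))" for u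
  proof -
    have "k u = L ((b, 0) + (\<psi> (u *\<^sub>R b) / u) *\<^sub>R (0, 1))"
      by (simp add: k_def)
    then show ?thesis
      by (simp only: linear_add[OF L] linear_cmul[OF L] linear_add[OF lin] linear_cmul[OF lin] real_scaleR_def)
  qed
  have "((\<lambda>u. u *\<^sub>R b) \<longlongrightarrow> 0) (at 0)"
    by (auto intro!: tendsto_eq_intros)
  then have graph': "\<forall>\<^sub>F u in at 0. g (x + L (u *\<^sub>R b, \<psi> (u *\<^sub>R b))) = g x"
    using graph by (auto simp: filterlim_iff)
  \<comment> \<open>Along the graph the increment of \<open>g\<close> vanishes, so only the Taylor
    terms are left.\<close>
  have 1: "((\<lambda>u. - ?D (L (b, 0)) / u - \<psi> (u *\<^sub>R b) / u\<^sup>2 * ?D (L (0, 1))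
           - second_derivative g x (k u) (k u) / 2) \<longlongrightarrow> 0) (at 0)"
  proof (rule Lim_transform_eventually)
    show "((\<lambda>u. (g (x + u *\<^sub>R k u) - g x - u * ?D (k u)) / u\<^sup>2
           - second_derivative g x (k u) (k u) / 2) \<longlongrightarrow> 0) (at 0)"
      by (rule taylor_second_order_scaled[OF g tendsto_ident_at nz \<open>Bfun k (at 0)\<close>])
    show "\<forall>\<^sub>F u in at 0. (g (x + u *\<^sub>R k u) - g x - u * ?D (k u)) / u\<^sup>2
           - second_derivative g x (k u) (k u) / 2 =
        - ?D (L (b, 0)) / u - \<psi> (u *\<^sub>R b) / u\<^sup>2 * ?D (L (0, 1)) - second_derivative g x (k u) (k u) / 2"
      using graph' nz
      by eventually_elim (simp add: uk Dk power2_eq_square field_simps)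
  qed
  have D2k: "((\<lambda>u. second_derivative g x (k u) (k u)) \<longlongrightarrow>
      second_derivative g x (L (b, 0)) (L (b, 0))) (at 0)"
    using k k by (rule D2.tendsto)
  \<comment> \<open>Adding back the terms with known limits shows that a constant divided by
    \<open>u\<close> converges. The constant is therefore 0, and then so is the limit, which is the
    second identity.\<close>
  have "((\<lambda>u. (- ?D (L (b, 0)) / u - \<psi> (u *\<^sub>R b) / u\<^sup>2 * ?D (L (0, 1))
           - second_derivative g x (k u) (k u) / 2) + \<psi> (u *\<^sub>R b) / u\<^sup>2 * ?D (L (0, 1))
           + second_derivative g x (k u) (k u) / 2) \<longlongrightarrow>
       0 + second_derivative \<psi> 0 b b / 2 * ?D (L (0, 1))
       + second_derivative g x (L (b, 0)) (L (b, 0)) / 2) (at 0)"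
    by (rule tendsto_add[OF tendsto_add[OF 1 tendsto_mult[OF \<psi>2 tendsto_const]]
          tendsto_divide[OF D2k tendsto_const]]) simp
  then have lim: "((\<lambda>u. - ?D (L (b, 0)) / u) \<longlongrightarrow> second_derivative \<psi> 0 b b / 2 * ?D (L (0, 1))
       + second_derivative g x (L (b, 0)) (L (b, 0)) / 2) (at 0)"
    by simp
  have "((\<lambda>u::real. - ?D (L (b, 0))) \<longlongrightarrow> 0) (at 0)"
  proof (rule Lim_transform_eventually)
    show "((\<lambda>u. u * (- ?D (L (b, 0)) / u)) \<longlongrightarrow> 0) (at 0)"
      using tendsto_mult[OF tendsto_ident_at lim] by simp
    show "\<forall>\<^sub>F u in at 0. u * (- ?D (L (b, 0)) / u) = - ?D (L (b, 0))"
      using nz by eventually_elim simp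
  qed
  then show D0: "?D (L (b, 0)) = 0"
    by (simp add: tendsto_const_iff)
  show "second_derivative g x (L (b, 0)) (L (b, 0)) = - ?D (L (0, 1)) * second_derivative \<psi> 0 b b"
    using lim by (simp add: D0 tendsto_const_iff field_simps add_eq_0_iff)
qed

lemma second_derivative_nondegenerate:
  fixes \<psi> :: "real^'d::finite \<Rightarrow> real"
  assumes \<psi>: "twice_differentiable_at \<psi> x" and "det (hessian \<psi> x) \<noteq> 0" and "v \<noteq> 0"
  shows "\<exists>w. second_derivative \<psi> x v w \<noteq> 0"
proof (rule ccontr)
  assume "\<not> ?thesis"
  then have 0: "second_derivative \<psi> x v w = 0" for w by blast
  interpret D2: bounded_bilinear "second_derivative \<psi> x"
    using \<psi> by (rule bounded_bilinear_second_derivative)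
  \<comment> \<open>The column index is differentiated first, so multiplying the matrix by
    \<open>v\<close> puts \<open>v\<close> into the first argument.\<close>
  have hess: "hessian \<psi> x $ i $ j = second_derivative \<psi> x (axis j 1) (axis i 1)" for i j
    by (simp add: hessian_def partial_deriv_def[abs_def] second_derivative_def)
  have "(hessian \<psi> x *v v) $ i = 0" for i
  proof -
    have "(hessian \<psi> x *v v) $ i = second_derivative \<psi> x (\<Sum>j\<in>UNIV. (v $ j) *s axis j 1) (axis i 1)"
      by (simp add: matrix_vector_mult_def hess D2.sum_left scalar_mult_eq_scaleR D2.scaleR_left mult.commute)
    also have "\<dots> = 0"
      by (simp add: basis_expansion 0)
    finally show ?thesis .
  qed
  then have "hessian \<psi> x *v v = 0"
    by (simp add: vec_eq_iff)
  moreover have "invertible (hessian \<psi> x)"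
    using assms(2) by (simp add: invertible_det_nz)
  ultimately show False
    using \<open>v \<noteq> 0\<close> by (metis invertible_def matrix_left_invertible_ker)
qed

text \<open>On tangent vectors the second derivative of \<open>q\<close> is a nonzero multiple of
  that of \<open>\<psi>\<close>, whose Hessian has determinant \<open>\<kappa>\<close>;
  diagonalising the latter gives the \<open>e i\<close>. The index set \<open>J\<close> is left free
  so that it can become \<open>{2..n}\<close>.\<close>

lemma gauss_kronecker_nonzero_imp_normal_form:
  fixes q :: "real^'n::finite \<Rightarrow> real"
  assumes q: "twice_differentiable_at q \<theta>" and "\<bar>q \<theta>\<bar> = 1" and D\<theta>: "frechet_derivative q (at \<theta>) \<theta> \<noteq> 0"
    and curv: "has_gauss_kronecker_curvature TYPE('d::finite) {x. \<bar>q x\<bar> = 1} \<nu> \<theta> \<kappa>" and "\<kappa> \<noteq> 0"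
    and J: "finite J" "card J = CARD('d)"
  obtains \<epsilon> :: "'i \<Rightarrow> real" and e :: "'i \<Rightarrow> real^'n" where
    "\<And>i. i \<in> J \<Longrightarrow> \<epsilon> i \<in> {1, -1}"
    "\<And>u. frechet_derivative q (at \<theta>) (\<Sum>i\<in>J. u i *\<^sub>R e i) = 0"
    "\<And>u. second_derivative q \<theta> (\<Sum>i\<in>J. u i *\<^sub>R e i) (\<Sum>i\<in>J. u i *\<^sub>R e i) = 2 * pi * (\<Sum>i\<in>J. \<epsilon> i * (u i)\<^sup>2)"
    "\<And>u i. (\<Sum>i\<in>J. u i *\<^sub>R e i) = 0 \<Longrightarrow> i \<in> J \<Longrightarrow> u i = 0"
proof -
  obtain A :: "real^'n \<Rightarrow> (real^'d) \<times> real" and \<psi> U where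
    A: "linear A" "\<And>x. norm (A x) = norm x" "surj A"
    and C3: "C_k_on 3 \<psi> UNIV" and \<psi>0: "\<psi> 0 = 0" "GDERIV \<psi> 0 :> 0" and U: "open U" "0 \<in> U"
    and graph: "(\<lambda>x. A (x - \<theta>)) ` {x. \<bar>q x\<bar> = 1} \<inter> U = range (\<lambda>y. (y, \<psi> y)) \<inter> U"
    and det: "\<kappa> = det (hessian \<psi> 0)"
    using curv unfolding has_gauss_kronecker_curvature_def by blast
  have \<psi>: "twice_differentiable_at \<psi> 0"
    using C3 by (intro C_k_on_imp_twice_differentiable_at[of 1 \<psi> UNIV]) (simp_all add: numeral_3_eq_3)
  have d\<psi>: "(\<psi> has_derivative (\<lambda>_. 0)) (at 0)"
    using \<psi>0(2) by (simp add: gderiv_def)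
  have "inj A"
    using A(2) by (intro linear_injective_0[OF A(1), THEN iffD2]) (metis norm_eq_zero)
  define L where "L = inv A"
  have AL: "A (L z) = z" for z
    using A(3) by (simp add: L_def surj_f_inv_f)
  have LA: "L (A x) = x" for x
    using \<open>inj A\<close> by (simp add: L_def)
  have L: "linear L"
    by (intro linearI injD[OF \<open>inj A\<close>]) (simp_all add: AL linear_add[OF A(1)] linear_cmul[OF A(1)])
  then have contL: "bounded_linear L"
    by (simp add: linear_conv_bounded_linear)
  have "isCont \<psi> 0"
    using d\<psi> by (rule has_derivative_continuous)
  then have "(\<psi> \<longlongrightarrow> \<psi> 0) (nhds 0)"
    by (simp only: isCont_def tendsto_at_iff_tendsto_nhds)
  then have lim: "((\<lambda>y. (y, \<psi> y)) \<longlongrightarrow> 0) (nhds 0)"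
    unfolding zero_prod_def using \<psi>0(1)
    by (intro tendsto_Pair filterlim_ident) simp
  have "(q \<longlongrightarrow> q \<theta>) (nhds \<theta>)"
    using twice_differentiable_at_imp_differentiable[OF q] differentiable_imp_continuous_within
    by (metis continuous_within tendsto_at_iff_tendsto_nhds)
  moreover have "((\<lambda>y. \<theta> + L (y, \<psi> y)) \<longlongrightarrow> \<theta>) (nhds 0)"
    using tendsto_add[OF tendsto_const bounded_linear.tendsto[OF contL lim], of \<theta>]
    by (simp add: linear_0[OF L])
  ultimately have "((\<lambda>y. q (\<theta> + L (y, \<psi> y))) \<longlongrightarrow> q \<theta>) (nhds 0)"
    by (rule filterlim_compose)
  \<comment> \<open>The set contains both levels 1 and -1 of \<open>q\<close>. Being within distance
    1 of \<open>q \<theta>\<close> excludes the opposite sign.\<close>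
  then have "\<forall>\<^sub>F y in nhds 0. dist (q (\<theta> + L (y, \<psi> y))) (q \<theta>) < 1"
    by (rule tendstoD) simp
  moreover have "\<forall>\<^sub>F y in nhds 0. (y, \<psi> y) \<in> U"
    using lim U by (rule topological_tendstoD)
  ultimately have level: "\<forall>\<^sub>F y in nhds 0. q (\<theta> + L (y, \<psi> y)) = q \<theta>"
  proof eventually_elim
    case (elim y)
    then have "(y, \<psi> y) \<in> (\<lambda>x. A (x - \<theta>)) ` {x. \<bar>q x\<bar> = 1}"
      using graph by blast
    then obtain x where "\<bar>q x\<bar> = 1" "A (x - \<theta>) = (y, \<psi> y)"
      by auto
    then have "\<bar>q (\<theta> + L (y, \<psi> y))\<bar> = 1"
      using LA[of "x - \<theta>"] by (simp add: algebra_simps)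
    then show ?case
      using elim(1) \<open>\<bar>q \<theta>\<bar> = 1\<close> by (auto simp: dist_real_def)
  qed
  note form = second_derivative_on_level_set_graph[OF q \<psi> \<psi>0(1) d\<psi> L level]
  define B where "B = second_derivative \<psi> 0"
  interpret B: bounded_bilinear B
    unfolding B_def by (rule bounded_bilinear_second_derivative[OF \<psi>])
  interpret D2: bounded_bilinear "second_derivative q \<theta>"
    using q by (rule bounded_bilinear_second_derivative)
  have lin: "linear (frechet_derivative q (at \<theta>))"
    using q by (intro linear_frechet_derivative twice_differentiable_at_imp_differentiable)
  define c where "c = frechet_derivative q (at \<theta>) (L (0, 1))"
  \<comment> \<open>The differential of \<open>q\<close> vanishes on tangent vectors, so
    \<open>c = 0\<close> would make it vanish everywhere, in particular at
    \<open>\<theta>\<close>.\<close>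
  have "c \<noteq> 0"
  proof
    assume "c = 0"
    obtain b r where br: "A \<theta> = (b, r)" by fastforce
    have "\<theta> = L ((b, 0) + r *\<^sub>R (0, 1))"
      using LA[of \<theta>] by (simp add: br)
    also have "\<dots> = L (b, 0) + r *\<^sub>R L (0, 1)"
      by (simp only: linear_add[OF L] linear_cmul[OF L])
    finally have "frechet_derivative q (at \<theta>) \<theta> = frechet_derivative q (at \<theta>) (L (b, 0) + r *\<^sub>R L (0, 1))"
      by simp
    also have "\<dots> = 0"
      using \<open>c = 0\<close> form(1) by (simp add: linear_add[OF lin] linear_cmul[OF lin] c_def)
    finally show False using D\<theta> by simp
  qed
  obtain S where S: "independent S" "span S = UNIV" "\<And>v. v \<in> S \<Longrightarrow> B v v \<in> {1, -1}"
    "\<And>v w. v \<in> S \<Longrightarrow> w \<in> S \<Longrightarrow> v \<noteq> w \<Longrightarrow> B v w = 0"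
  proof (rule ex_pm1_orthonormal_basis)
    show "bounded_bilinear B" by (rule B.bounded_bilinear_axioms)
    show "B v w = B w v" for v w
      unfolding B_def by (rule second_derivative_commute[OF \<psi>])
    show "\<exists>w. B v w \<noteq> 0" if "v \<noteq> 0" for v
      unfolding B_def using \<open>\<kappa> \<noteq> 0\<close> det that by (intro second_derivative_nondegenerate[OF \<psi>]) auto
  qed blast
  have "finite S"
    using S(1) independent_bound by blast
  moreover have "card S = CARD('d)"
    using dim_eq_card[of S UNIV] S(1,2) by simp
  ultimately obtain v where v: "bij_betw v J S"
    using J finite_same_card_bij by metis
  have vS: "v i \<in> S" if "i \<in> J" for i
    using v that by (auto simp: bij_betw_def)
  have vne: "v i \<noteq> v j" if "i \<in> J" "j \<in> J" "i \<noteq> j" for i j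
    using v that by (auto simp: bij_betw_def inj_on_def)
  \<comment> \<open>By \<open>form(2)\<close> the second derivative of \<open>q\<close> on
    \<open>L (v i, 0)\<close> is \<open>- c * B (v i) (v i)\<close>. The factor makes this
    \<open>2 * pi\<close> times the sign \<open>- sgn c * B (v i) (v i)\<close>.\<close>
  define e where "e i = sqrt (2 * pi / \<bar>c\<bar>) *\<^sub>R L (v i, 0)" for i
  have sum_e: "(\<Sum>i\<in>J. u i *\<^sub>R e i) = sqrt (2 * pi / \<bar>c\<bar>) *\<^sub>R L (\<Sum>i\<in>J. u i *\<^sub>R v i, 0)" for u
  proof -
    have "(\<Sum>i\<in>J. u i *\<^sub>R v i, 0) = (\<Sum>i\<in>J. u i *\<^sub>R (v i, 0::real))"
      by (auto simp: prod_eq_iff fst_sum snd_sum)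
    then show ?thesis
      by (simp only: linear_sum[OF L] linear_cmul[OF L]) (simp add: e_def scaleR_sum_right mult.commute)
  qed
  show thesis
  proof (rule that)
    show "- sgn c * B (v i) (v i) \<in> {1, -1}" if "i \<in> J" for i
      using S(3)[OF vS[OF that]] \<open>c \<noteq> 0\<close> by (auto simp: sgn_if)
    show "frechet_derivative q (at \<theta>) (\<Sum>i\<in>J. u i *\<^sub>R e i) = 0" for u
      by (simp add: sum_e linear_cmul[OF lin] form(1))
    show "second_derivative q \<theta> (\<Sum>i\<in>J. u i *\<^sub>R e i) (\<Sum>i\<in>J. u i *\<^sub>R e i)
        = 2 * pi * (\<Sum>i\<in>J. (- sgn c * B (v i) (v i)) * (u i)\<^sup>2)" for u
    proof -
      have "B (\<Sum>i\<in>J. u i *\<^sub>R v i) (\<Sum>i\<in>J. u i *\<^sub>R v i) = (\<Sum>i\<in>J. \<Sum>j\<in>J. u i * (u j * B (v i) (v j)))"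
        by (simp add: B.sum_left B.sum_right B.scaleR_left B.scaleR_right sum_distrib_left)
          (auto intro!: sum.cong simp: B_def second_derivative_commute[OF \<psi>])
      also have "\<dots> = (\<Sum>i\<in>J. \<Sum>j\<in>J. if i = j then u i * (u i * B (v i) (v i)) else 0)"
        by (intro sum.cong refl) (auto simp: S(4) vS vne)
      also have "\<dots> = (\<Sum>i\<in>J. B (v i) (v i) * (u i)\<^sup>2)"
        using J(1) by (simp add: power2_eq_square mult_ac)
      finally have BB: "B (\<Sum>i\<in>J. u i *\<^sub>R v i) (\<Sum>i\<in>J. u i *\<^sub>R v i) = (\<Sum>i\<in>J. B (v i) (v i) * (u i)\<^sup>2)" .
      have "second_derivative q \<theta> (\<Sum>i\<in>J. u i *\<^sub>R e i) (\<Sum>i\<in>J. u i *\<^sub>R e i)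
          = (sqrt (2 * pi / \<bar>c\<bar>))\<^sup>2 * (- c * (\<Sum>i\<in>J. B (v i) (v i) * (u i)\<^sup>2))"
        by (simp only: sum_e D2.scaleR_left D2.scaleR_right form(2) B_def[symmetric] BB c_def[symmetric])
          (simp only: real_scaleR_def power2_eq_square mult.assoc)
      also have "\<dots> = 2 * pi * (- (c / \<bar>c\<bar>) * (\<Sum>i\<in>J. B (v i) (v i) * (u i)\<^sup>2))"
        by simp
      also have "c / \<bar>c\<bar> = sgn c"
        by (simp add: sgn_if)
      finally show ?thesis
        by (simp add: sum_distrib_left mult.assoc)
    qed
    show "u i = 0" if "(\<Sum>i\<in>J. u i *\<^sub>R e i) = 0" "i \<in> J" for u i
    proof -
      have "L (\<Sum>i\<in>J. u i *\<^sub>R v i, 0) = 0"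
        using that(1) \<open>c \<noteq> 0\<close> by (simp add: sum_e)
      then have "(\<Sum>i\<in>J. u i *\<^sub>R v i, 0::real) = 0"
        using AL linear_0[OF A(1)] by metis
      then have "(\<Sum>i\<in>J. u i *\<^sub>R v i) = 0"
        by (simp add: zero_prod_def)
      \<comment> \<open>Independence concerns the set \<open>S\<close>, so the coefficients are
        carried over from \<open>J\<close> by the inverse of \<open>v\<close>.\<close>
      moreover have inv: "inv_into J v (v i) = i" if "i \<in> J" for i
        using v that by (simp add: bij_betw_def)
      then have "(\<Sum>i\<in>J. u i *\<^sub>R v i) = (\<Sum>i\<in>J. u (inv_into J v (v i)) *\<^sub>R v i)"
        by (intro sum.cong) auto
      then have "(\<Sum>i\<in>J. u i *\<^sub>R v i) = (\<Sum>s\<in>S. u (inv_into J v s) *\<^sub>R s)"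
        using sum.reindex_bij_betw[OF v, of "\<lambda>s. u (inv_into J v s) *\<^sub>R s"] by simp
      ultimately have "u (inv_into J v (v i)) = 0"
        using independentD[OF S(1) \<open>finite S\<close> subset_refl, of "\<lambda>s. u (inv_into J v s)" "v i"] vS[OF that(2)]
        by simp
      then show ?thesis
        by (simp add: inv[OF that(2)])
    qed
  qed
qed

section \<open>From the limit of the exponents to the quotients of \<open>f\<close>\<close>

theorem theorem9:
  fixes n m :: nat
    and c :: "nat \<Rightarrow> 'n::finite"
    and p :: "nat \<Rightarrow> real"
    and q :: "nat \<Rightarrow> real^'n \<Rightarrow> real"
    and f :: "real^'n \<Rightarrow> real"
    and M :: "(real^'n) set"
    and \<theta> \<nu> :: "real^'n"
    and \<kappa> :: real
  assumes "n = CARD('n)" and "n = CARD('d::finite) + 1" and "n \<ge> 2" and "m \<ge> 2"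
    and "bij_betw c {1..n} UNIV"
    and "\<And>i. i \<in> {1..m} \<Longrightarrow> p i > 0"
    and "\<And>i. i \<in> {1..m} \<Longrightarrow> continuous_on UNIV (q i)"
    and "\<And>i. i \<in> {1..m} \<Longrightarrow> C_k_on 3 (q i) (UNIV - {0})"
    and "\<And>i. i \<in> {1..m} \<Longrightarrow> \<exists>x. q i x \<noteq> 0"
    and "\<And>i x \<alpha>. i \<in> {1..m} \<Longrightarrow> \<alpha> \<ge> 0 \<Longrightarrow> q i (\<alpha> *\<^sub>R x) = \<alpha> powr p i * q i x"
    and "p 1 > Max (p ` {2..m})"
    and "f = (\<lambda>x. exp (- (\<Sum>i=1..m. q i x)))"
    and "M = {x. \<bar>q 1 x\<bar> = 1}"
    and "\<theta> \<in> M"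
    and "has_gauss_kronecker_curvature TYPE('d) M \<nu> \<theta> \<kappa>"
    and "\<kappa> \<noteq> 0"
  shows "\<exists>(\<epsilon> :: nat \<Rightarrow> real) (T :: real \<Rightarrow> real^'n^'n).
           (\<forall>i\<in>{2..n}. \<epsilon> i \<in> {1, -1}) \<and>
           (\<forall>t\<ge>1. invertible (T t)) \<and>
           (\<forall>K. compact K \<longrightarrow>
             uniform_limit K
               (\<lambda>t x. f (t *\<^sub>R \<theta> + T t *v x) / f (t *\<^sub>R \<theta>))
               (\<lambda>x. exp (- x $ c 1 - pi * (\<Sum>i=2..n. \<epsilon> i * (x $ c i)\<^sup>2)))
               at_top)"
proof -
  have I: "1 \<in> {1..m}" using \<open>m \<ge> 2\<close> by simp
  \<comment> \<open>Homogeneity with \<open>\<alpha> = 0\<close>, where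
    \<open>0 powr p 1 = 0\<close>. Hence \<open>\<theta>\<close> is not the origin, and the
    \<open>q i\<close> are smooth near it.\<close>
  have q0: "q 1 0 = 0"
    using assms(10)[OF I, of 0 0] by simp
  have \<theta>1: "\<bar>q 1 \<theta>\<bar> = 1"
    using assms(13,14) by simp
  have "\<theta> \<noteq> 0"
    using q0 \<theta>1 by auto
  have q: "twice_differentiable_at (q i) \<theta>" if "i \<in> {1..m}" for i
    using assms(8)[OF that] \<open>\<theta> \<noteq> 0\<close>
    by (intro C_k_on_imp_twice_differentiable_at[of 1 _ "UNIV - {0}"]) (auto simp: numeral_3_eq_3)
  have "frechet_derivative (q 1) (at \<theta>) \<theta> = p 1 * q 1 \<theta>"
    by (rule euler_homogeneous[OF twice_differentiable_at_imp_differentiable[OF q[OF I]] assms(10)[OF I]])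
  then have D\<theta>: "frechet_derivative (q 1) (at \<theta>) \<theta> \<noteq> 0"
    using assms(6)[OF I] \<theta>1 by auto
  obtain \<epsilon> :: "nat \<Rightarrow> real" and e where
    \<epsilon>: "\<And>i. i \<in> {2..n} \<Longrightarrow> \<epsilon> i \<in> {1, -1}"
    and e1: "\<And>u. frechet_derivative (q 1) (at \<theta>) (\<Sum>i=2..n. u i *\<^sub>R e i) = 0"
    and e2: "\<And>u. second_derivative (q 1) \<theta> (\<Sum>i=2..n. u i *\<^sub>R e i) (\<Sum>i=2..n. u i *\<^sub>R e i)
        = 2 * pi * (\<Sum>i=2..n. \<epsilon> i * (u i)\<^sup>2)"
    and e3: "\<And>u i. (\<Sum>i=2..n. u i *\<^sub>R e i) = 0 \<Longrightarrow> i \<in> {2..n} \<Longrightarrow> u i = 0"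
  proof -
    have "card {2..n} = CARD('d)" using assms(2) by simp
    then show thesis
      by (rule gauss_kronecker_nonzero_imp_normal_form[OF q[OF I] \<theta>1 D\<theta>
            assms(15)[unfolded assms(13)] assms(16) finite_atLeastAtMost]) (rule that; assumption)
  qed
  define w where "w x = (\<Sum>i=2..n. (x $ c i) *\<^sub>R e i)" for x :: "real^'n"
  have w: "linear w"
    unfolding w_def by (intro linearI) (auto simp: scaleR_left_distrib sum.distrib scaleR_sum_right)
  have l: "linear (\<lambda>x :: real^'n. x $ c 1)"
    by (intro linearI) auto
  have p: "p i < p 1" if "i \<in> {1..m}" "i \<noteq> 1" for i
  proof -
    have "p i \<le> Max (p ` {2..m})" using that by (intro Max_ge) auto
    then show ?thesis using assms(11) by simp
  qed
  obtain H :: "real \<Rightarrow> real^'n \<Rightarrow> real^'n" where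
    H: "\<forall>\<^sub>F t in at_top. linear (H t) \<and> (\<forall>x. H t x = 0 \<longrightarrow> w x = 0 \<and> x $ c 1 = 0)"
    and lim: "\<And>K. compact K \<Longrightarrow>
       uniform_limit K (\<lambda>t x. \<Sum>i=1..m. t powr p i * (q i (\<theta> + H t x) - q i \<theta>))
       (\<lambda>x. x $ c 1 + second_derivative (q 1) \<theta> (w x) (w x) / 2) at_top"
    using anisotropic_rescaling[of "{1..m}" 1 p q \<theta> w "\<lambda>x. x $ c 1"] I p q D\<theta> w l assms(6)[OF I] e1
    by (auto simp: w_def)
  define good where "good t \<longleftrightarrow> linear (H t) \<and> (\<forall>x. H t x = 0 \<longrightarrow> w x = 0 \<and> x $ c 1 = 0)" for t
  \<comment> \<open>The factor \<open>t\<close> gives \<open>t *\<^sub>R (\<theta> + H t x)\<close>,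
    to which homogeneity applies. The identity is a default that keeps \<open>T t\<close> invertible
    where \<open>H t\<close> is not good, which is excluded for large \<open>t\<close>.\<close>
  define T where "T t = (if good t then matrix (\<lambda>x. t *\<^sub>R H t x) else mat 1)" for t
  have T_mult: "T t *v x = t *\<^sub>R H t x" if "good t" for t x
  proof -
    have "linear (\<lambda>x. t *\<^sub>R H t x)"
      using that by (intro linear_compose_scale_right) (simp add: good_def)
    then show ?thesis
      using that by (simp add: T_def matrix_works)
  qed
  have "invertible (T t)" if "t \<ge> 1" for t
  proof (cases "good t")
    case True
    have "x = 0" if "T t *v x = 0" for x
    proof -
      have "H t x = 0"
        using that \<open>t \<ge> 1\<close> by (simp add: T_mult[OF True])
      then have "w x = 0" and 1: "x $ c 1 = 0"
        using True by (auto simp: good_def)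
      \<comment> \<open>The \<open>e i\<close> are linearly independent by \<open>e3\<close>, so
        \<open>w x = 0\<close> kills every coordinate but the first in the order \<open>c\<close>;
        that one is \<open>l\<close>.\<close>
      then have "x $ c i = 0" if "i \<in> {2..n}" for i
        using e3[of "\<lambda>i. x $ c i"] that by (simp add: w_def)
      with 1 have c: "x $ c i = 0" if "i \<in> {1..n}" for i
        using that by (cases "i = 1") auto
      have "x $ j = 0" for j
      proof -
        have "j \<in> c ` {1..n}"
          using assms(5) by (simp add: bij_betw_def)
        then show ?thesis using c by auto
      qed
      then show ?thesis by (simp add: vec_eq_iff)
    qed
    then show ?thesis
      unfolding invertible_left_inverse matrix_left_invertible_ker by blast
  next
    case False
    then show ?thesis
      using matrix_mul_lid by (auto simp: T_def invertible_def)
  qed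
  moreover have "uniform_limit K (\<lambda>t x. f (t *\<^sub>R \<theta> + T t *v x) / f (t *\<^sub>R \<theta>))
      (\<lambda>x. exp (- x $ c 1 - pi * (\<Sum>i=2..n. \<epsilon> i * (x $ c i)\<^sup>2))) at_top" if K: "compact K" for K
  proof -
    have "f (t *\<^sub>R \<theta> + T t *v x) / f (t *\<^sub>R \<theta>) =
        exp (- (\<Sum>i=1..m. t powr p i * (q i (\<theta> + H t x) - q i \<theta>)))" if "good t" "t > 0" for t x
    proof -
      have "f (t *\<^sub>R \<theta> + T t *v x) = exp (- (\<Sum>i=1..m. t powr p i * q i (\<theta> + H t x)))"
        and "f (t *\<^sub>R \<theta>) = exp (- (\<Sum>i=1..m. t powr p i * q i \<theta>))"
        using that assms(10) by (simp_all add: assms(12) T_mult scaleR_add_right[symmetric])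
      then show ?thesis
        by (simp add: right_diff_distrib sum_subtractf flip: exp_diff)
    qed
    moreover have "\<forall>\<^sub>F t in at_top. good t \<and> t > 0"
      unfolding good_def using H eventually_gt_at_top by (rule eventually_conj)
    ultimately have ev: "\<forall>\<^sub>F t in at_top. \<forall>x\<in>K. exp (- (\<Sum>i=1..m. t powr p i * (q i (\<theta> + H t x) - q i \<theta>))) =
        f (t *\<^sub>R \<theta> + T t *v x) / f (t *\<^sub>R \<theta>)"
      by (auto elim!: eventually_mono)
    have "uniform_limit K (\<lambda>t x. exp (- (\<Sum>i=1..m. t powr p i * (q i (\<theta> + H t x) - q i \<theta>))))
      (\<lambda>x. exp (- (x $ c 1 + pi * (\<Sum>i=2..n. \<epsilon> i * (x $ c i)\<^sup>2)))) at_top"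
    proof (rule uniform_limit_exp_uminus)
      show "uniform_limit K (\<lambda>t x. \<Sum>i=1..m. t powr p i * (q i (\<theta> + H t x) - q i \<theta>))
          (\<lambda>x. x $ c 1 + pi * (\<Sum>i=2..n. \<epsilon> i * (x $ c i)\<^sup>2)) at_top"
        \<comment> \<open>The factor \<open>2 * pi\<close> in \<open>e2\<close>, halved by Taylor's
          formula, becomes \<open>pi\<close>.\<close>
        using lim[OF K] by (simp add: w_def e2 del: One_nat_def)
    qed (intro continuous_intros K)+
    then have "uniform_limit K (\<lambda>t x. f (t *\<^sub>R \<theta> + T t *v x) / f (t *\<^sub>R \<theta>))
        (\<lambda>x. exp (- (x $ c 1 + pi * (\<Sum>i=2..n. \<epsilon> i * (x $ c i)\<^sup>2)))) at_top"
      by (simp only: uniform_limit_cong[OF ev refl])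
    then show ?thesis by simp
  qed
  ultimately show ?thesis
    using \<epsilon> by (intro exI[of _ \<epsilon>] exI[of _ T] conjI ballI allI impI)
qed

end
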